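(* For every field $K$ and every non-empty set $X$, the first-order theory of the free associative unitary algebra $\mathbb{A}_K(X)$, in the language of rings, is undecidable.
   Context: $\mathbb{A}_K(X)$ denotes the free associative unitary algebra over the field $K$ with free basis $X$ (the algebra of non-commutative polynomials in the variables $X$ with coefficients in $K$). It is regarded as a first-order structure in the language of rings $\{+,\cdot,0,1\}$. *)

theory Defs
  imports "HOL-Library.Poly_Mapping" "HOL-Library.Nat_Bijection" "HOL-Algebra.Ring"
begin

section \<open>The free associative unitary algebra\<close>

text \<open>The free monoid of words, written additively because \<^theory>\<open>HOL-Library.Poly_Mapping\<close>
  defines the convolution product for exponents in class \<^class>\<open>monoid_add\<close>
  (which is not assumed commutative). The type of finitely supported functions on words is
  thus the monoid ring of the free monoid.\<close>

datatype 'x word = Word (letters: "'x list")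

instantiation word :: (type) monoid_add
begin

definition zero_word :: "'a word" where
  "0 = Word []"

definition plus_word :: "'a word \<Rightarrow> 'a word \<Rightarrow> 'a word" where
  "u + v = Word (letters u @ letters v)"

instance
  by standard (simp_all add: zero_word_def plus_word_def)

end

type_synonym ('x, 'k) ncpoly = "'x word \<Rightarrow>\<^sub>0 'k"

definition free_algebra :: "'x set \<Rightarrow> ('x, 'k::field) ncpoly ring" where
  "free_algebra X =
     \<lparr>carrier = {p. \<forall>w \<in> Poly_Mapping.keys p. set (letters w) \<subseteq> X},
      mult = (*), one = 1, zero = 0, add = (+)\<rparr>"

lemma ring_free_algebra: "ring (free_algebra X :: ('x, 'k::field) ncpoly ring)"
proof -
  let ?C = "{p :: ('x, 'k) ncpoly. \<forall>w \<in> Poly_Mapping.keys p. set (letters w) \<subseteq> X}"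
  have add: "p + q \<in> ?C" if "p \<in> ?C" "q \<in> ?C" for p q
    using that Poly_Mapping.keys_add[of p q] by blast
  have uminus: "- p \<in> ?C" if "p \<in> ?C" for p
    using that by (simp add: keys_minus)
  have mult: "p * q \<in> ?C" if "p \<in> ?C" "q \<in> ?C" for p q
  proof -
    have "set (letters w) \<subseteq> X" if w: "w \<in> Poly_Mapping.keys (p * q)" for w
    proof -
      obtain u v where "w = u + v" "u \<in> Poly_Mapping.keys p" "v \<in> Poly_Mapping.keys q"
        using w keys_mult[of p q] by blast
      then show ?thesis
        using \<open>p \<in> ?C\<close> \<open>q \<in> ?C\<close> by (auto simp: plus_word_def)
    qed
    then show ?thesis by blast
  qed
  have one: "1 \<in> ?C"
    by (simp add: zero_word_def)
  let ?F = "free_algebra X :: ('x, 'k) ncpoly ring"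
  have "abelian_group ?F"
  proof (rule abelian_groupI)
    show "p \<oplus>\<^bsub>?F\<^esub> q \<in> carrier ?F" if "p \<in> carrier ?F" "q \<in> carrier ?F" for p q
      using add[of p q] that unfolding free_algebra_def ring_record_simps partial_object.simps .
    show "\<exists>q\<in>carrier ?F. q \<oplus>\<^bsub>?F\<^esub> p = \<zero>\<^bsub>?F\<^esub>" if "p \<in> carrier ?F" for p
      using uminus[of p] that by (intro bexI[of _ "- p"]) (simp_all add: free_algebra_def)
  qed (simp_all add: free_algebra_def add.assoc add.commute)
  moreover have "Group.monoid ?F"
  proof (rule Group.monoidI)
    show "p \<otimes>\<^bsub>?F\<^esub> q \<in> carrier ?F" if "p \<in> carrier ?F" "q \<in> carrier ?F" for p q
      using mult[of p q] that
      unfolding free_algebra_def ring_record_simps monoid.simps partial_object.simps .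
    show "\<one>\<^bsub>?F\<^esub> \<in> carrier ?F"
      using one by (simp add: free_algebra_def)
  qed (simp_all add: free_algebra_def mult.assoc)
  ultimately show ?thesis
    by (rule ringI) (simp_all add: free_algebra_def distrib_left distrib_right)
qed


section \<open>First-order logic in the language of rings\<close>

datatype tm = Var nat | Zero | One | Add tm tm | Mul tm tm

datatype fm = Eq tm tm | Neg fm | Conj fm fm | Exists nat fm

primrec tm_vars :: "tm \<Rightarrow> nat set" where
  "tm_vars (Var i) = {i}"
| "tm_vars Zero = {}"
| "tm_vars One = {}"
| "tm_vars (Add s t) = tm_vars s \<union> tm_vars t"
| "tm_vars (Mul s t) = tm_vars s \<union> tm_vars t"

primrec free_vars :: "fm \<Rightarrow> nat set" where
  "free_vars (Eq s t) = tm_vars s \<union> tm_vars t"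
| "free_vars (Neg \<phi>) = free_vars \<phi>"
| "free_vars (Conj \<phi> \<psi>) = free_vars \<phi> \<union> free_vars \<psi>"
| "free_vars (Exists i \<phi>) = free_vars \<phi> - {i}"

definition sentence :: "fm \<Rightarrow> bool" where
  "sentence \<phi> \<longleftrightarrow> free_vars \<phi> = {}"

primrec tm_val :: "('a, 'm) ring_scheme \<Rightarrow> (nat \<Rightarrow> 'a) \<Rightarrow> tm \<Rightarrow> 'a" where
  "tm_val R e (Var i) = e i"
| "tm_val R e Zero = \<zero>\<^bsub>R\<^esub>"
| "tm_val R e One = \<one>\<^bsub>R\<^esub>"
| "tm_val R e (Add s t) = tm_val R e s \<oplus>\<^bsub>R\<^esub> tm_val R e t"
| "tm_val R e (Mul s t) = tm_val R e s \<otimes>\<^bsub>R\<^esub> tm_val R e t"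

primrec sat :: "('a, 'm) ring_scheme \<Rightarrow> (nat \<Rightarrow> 'a) \<Rightarrow> fm \<Rightarrow> bool" where
  "sat R e (Eq s t) \<longleftrightarrow> tm_val R e s = tm_val R e t"
| "sat R e (Neg \<phi>) \<longleftrightarrow> \<not> sat R e \<phi>"
| "sat R e (Conj \<phi> \<psi>) \<longleftrightarrow> sat R e \<phi> \<and> sat R e \<psi>"
| "sat R e (Exists i \<phi>) \<longleftrightarrow> (\<exists>a \<in> carrier R. sat R (e(i := a)) \<phi>)"

definition fo_theory :: "('a, 'm) ring_scheme \<Rightarrow> fm set" where
  "fo_theory R = {\<phi>. sentence \<phi> \<and> (\<forall>e. range e \<subseteq> carrier R \<longrightarrow> sat R e \<phi>)}"


section \<open>Decidability\<close>

text \<open>Programs for the partial recursive functions. \<open>computes f xs y\<close> means that \<open>f\<close> halts on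
  the input \<open>xs\<close> with output \<open>y\<close>. Recursion and minimization act on the first argument. Arities
  are not tracked: surplus arguments are passed on or ignored.\<close>

datatype recf =
  RZero | RSucc | RProj nat | RComp recf "recf list" | RPrim recf recf | RMu recf

inductive computes :: "recf \<Rightarrow> nat list \<Rightarrow> nat \<Rightarrow> bool" where
  zero: "computes RZero xs 0"
| succ: "computes RSucc (x # xs) (Suc x)"
| proj: "i < length xs \<Longrightarrow> computes (RProj i) xs (xs ! i)"
| comp: "list_all2 (\<lambda>g y. computes g xs y) gs ys \<Longrightarrow> computes f ys z \<Longrightarrow>
    computes (RComp f gs) xs z"
| prim_0: "computes f xs y \<Longrightarrow> computes (RPrim f g) (0 # xs) y"
| prim_Suc: "computes (RPrim f g) (n # xs) r \<Longrightarrow> computes g (n # r # xs) y \<Longrightarrow>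
    computes (RPrim f g) (Suc n # xs) y"
| mu: "computes f (n # xs) 0 \<Longrightarrow> (\<forall>m<n. \<exists>y. computes f (m # xs) (Suc y)) \<Longrightarrow>
    computes (RMu f) xs n"

lemma computes_deterministic: "computes f xs y \<Longrightarrow> computes f xs z \<Longrightarrow> y = z"
proof (induction f xs y arbitrary: z rule: computes.induct)
  case (zero xs) then show ?case by (cases rule: computes.cases) simp
next
  case (succ x xs) then show ?case by (cases rule: computes.cases) simp
next
  case (proj i xs) from proj.prems show ?case by (cases rule: computes.cases) simp
next
  case (prim_0 f xs y g)
  from prim_0.prems have "computes f xs z" by (cases rule: computes.cases)
  then show ?case by (rule prim_0.IH)
next
  case (prim_Suc f g n xs r y)
  from prim_Suc.prems obtain r'
    where "computes (RPrim f g) (n # xs) r'" "computes g (n # r' # xs) z"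
    by (cases rule: computes.cases)
  then show ?case using prim_Suc.IH by blast
next
  case (comp xs gs ys f y)
  from comp.prems obtain ys' where ys': "list_all2 (\<lambda>g y. computes g xs y) gs ys'"
    and z: "computes f ys' z"
    by (cases rule: computes.cases)
  have "ys = ys'"
  proof (rule nth_equalityI)
    show "length ys = length ys'"
      using list_all2_lengthD[OF comp.IH(1)] list_all2_lengthD[OF ys'] by simp
    show "ys ! i = ys' ! i" if "i < length ys" for i
    proof -
      have i: "i < length gs"
        using list_all2_lengthD[OF comp.IH(1)] that by simp
      show ?thesis
        using list_all2_nthD[OF comp.IH(1) i] list_all2_nthD[OF ys' i] by blast
    qed
  qed
  with comp.IH(2) z show ?case by simp
next
  case (mu f n xs)
  from mu.prems have z: "computes f (z # xs) 0 \<and> (\<forall>m<z. \<exists>y. computes f (m # xs) (Suc y))"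
    by (cases rule: computes.cases) blast
  show ?case
  proof (cases n z rule: linorder_cases)
    case less
    with z obtain y where "computes f (n # xs) (Suc y)" by blast
    then show ?thesis using mu.IH(1) by fastforce
  next
    case greater
    with mu.IH(2) obtain y where "\<And>v. computes f (z # xs) v \<Longrightarrow> Suc y = v" by blast
    from this[of 0] z show ?thesis by simp
  qed
qed

definition decidable_set :: "nat set \<Rightarrow> bool" where
  "decidable_set A \<longleftrightarrow> (\<exists>f. \<forall>n. computes f [n] (if n \<in> A then 1 else 0))"

primrec tm_code :: "tm \<Rightarrow> nat" where
  "tm_code (Var i) = prod_encode (0, i)"
| "tm_code Zero = prod_encode (1, 0)"
| "tm_code One = prod_encode (2, 0)"
| "tm_code (Add s t) = prod_encode (3, prod_encode (tm_code s, tm_code t))"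
| "tm_code (Mul s t) = prod_encode (4, prod_encode (tm_code s, tm_code t))"

primrec fm_code :: "fm \<Rightarrow> nat" where
  "fm_code (Eq s t) = prod_encode (0, prod_encode (tm_code s, tm_code t))"
| "fm_code (Neg \<phi>) = prod_encode (1, fm_code \<phi>)"
| "fm_code (Conj \<phi> \<psi>) = prod_encode (2, prod_encode (fm_code \<phi>, fm_code \<psi>))"
| "fm_code (Exists i \<phi>) = prod_encode (3, prod_encode (i, fm_code \<phi>))"

lemma tm_code_inject: "tm_code s = tm_code t \<longleftrightarrow> s = t"
proof (induction s arbitrary: t)
  case (Var i) show ?case by (cases t) auto
next
  case Zero show ?case by (cases t) auto
next
  case One show ?case by (cases t) auto
next
  case (Add s1 s2) then show ?case by (cases t) auto
next
  case (Mul s1 s2) then show ?case by (cases t) auto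
qed

lemma fm_code_inject: "fm_code \<phi> = fm_code \<psi> \<longleftrightarrow> \<phi> = \<psi>"
proof (induction \<phi> arbitrary: \<psi>)
  case (Eq s t) show ?case by (cases \<psi>) (auto simp: tm_code_inject)
next
  case (Neg \<phi>) then show ?case by (cases \<psi>) auto
next
  case (Conj \<phi>1 \<phi>2) then show ?case by (cases \<psi>) auto
next
  case (Exists i \<phi>) then show ?case by (cases \<psi>) auto
qed

definition decidable_theory :: "fm set \<Rightarrow> bool" where
  "decidable_theory T \<longleftrightarrow> decidable_set (fm_code ` T)"

end

(* Numbers are coded as powers of a parameter p. The set of powers of p is defined by a formula
   (b is congruent to 1 modulo p - 1, and every non-unit right factor of b is a left multiple
   of p) that is correct for every p satisfying a definable condition, which each letter x in X
   satisfies. Addition of exponents is multiplication. A finite sequence a(0), ..., a(n) of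
   exponents is coded by two elements F and h, a(i) being the least exponent a for which F - p^a
   is a right multiple of h - p^(i+1): with h the product of the p^d - 1 for 1 <= d <= N these
   moduli are comaximal already over the integers, so the Chinese remainder theorem applies in
   every characteristic. Hence all partial recursive functions are definable, and a decision
   procedure for the theory is refuted by the sentence asserting its own rejection. *)

theory Submission
  imports Defs "HOL-Computational_Algebra.Polynomial"
begin

section \<open>Comaximal integer polynomials\<close>

text \<open>The moduli transpose Goedel's beta function. His moduli \<open>1 + (i + 1) * b\<close>
  differ by multiples \<open>(j - i) * b\<close>; here two moduli differ, up to sign, by
  \<open>p^(i+1) * (p^(j-i) - 1)\<close>, and \<open>h\<close> is built so that the second factor
  divides it while its constant coefficient as a polynomial in \<open>p\<close> is a unit.
  Multiplication of exponents need not be defined beforehand: the witness of divisibility ranges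
  over the whole algebra instead of the powers, so ring multiplication does the work. That witness
  need not commute with \<open>p\<close>, which is why uniqueness is read off from degrees alone.
  Least exponents are taken because for arbitrary F and h a congruence may hold for several
  exponents. No constant of the language names a letter. Every relation is therefore defined by one
  formula that is correct for all admissible parameters; a statement about exponents has the same
  truth value for each of them, so a sentence may simply quantify the parameter
  existentially.\<close>

definition comax :: "'a::comm_ring_1 \<Rightarrow> 'a \<Rightarrow> bool" where
  "comax a b \<longleftrightarrow> (\<exists>s t. a * s + b * t = 1)"

lemma comax_mult:
  assumes "comax a b" "comax a c"
  shows "comax a (b * c)"
proof -
  obtain s t s' t' where st: "a * s + b * t = 1" "a * s' + c * t' = 1"
    using assms unfolding comax_def by blast
  have "a * (s + b * t * s') + (b * c) * (t * t') = a * s + b * t * (a * s' + c * t')"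
    by (simp add: algebra_simps)
  then have "a * (s + b * t * s') + (b * c) * (t * t') = 1"
    by (simp add: st)
  then show ?thesis unfolding comax_def by blast
qed

lemma comax_one: "comax a 1"
  unfolding comax_def by (rule exI[of _ 0], rule exI[of _ 1]) simp

lemma comax_commute: "comax a b \<longleftrightarrow> comax b a"
  unfolding comax_def by (auto simp: add.commute)

lemma comax_power: "comax a b \<Longrightarrow> comax a (b ^ n)"
  by (induction n) (simp_all add: comax_one comax_mult)

lemma comax_prod: "(\<And>i. i \<in> A \<Longrightarrow> comax a (f i)) \<Longrightarrow> comax a (prod f A)"
  by (induction A rule: infinite_finite_induct) (simp_all add: comax_one comax_mult)

lemma chinese_remainder_comax:
  fixes m y :: "nat \<Rightarrow> 'a::comm_ring_1"
  assumes "\<And>i j. i < j \<Longrightarrow> j < n \<Longrightarrow> comax (m i) (m j)"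
  shows "\<exists>F. \<forall>i<n. m i dvd F - y i"
  using assms
proof (induction n)
  case 0
  then show ?case by simp
next
  case (Suc n)
  have "\<exists>F. \<forall>i<n. m i dvd F - y i"
    by (rule Suc.IH) (rule Suc.prems, simp_all)
  then obtain F where F: "\<forall>i<n. m i dvd F - y i" ..
  have "comax (m n) (\<Prod>i<n. m i)"
    by (intro comax_prod, subst comax_commute) (rule Suc.prems, simp_all)
  then obtain s t where st: "m n * s + (\<Prod>i<n. m i) * t = 1"
    unfolding comax_def by blast
  \<comment> \<open>The product times \<open>t\<close> is 0 modulo the earlier moduli and 1 modulo
    \<open>m n\<close>, so the correction changes only the last residue.\<close>
  define G where "G = F + (\<Prod>i<n. m i) * (t * (y n - F))"
  have "m i dvd G - y i" if "i < Suc n" for i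
  proof (cases "i = n")
    case True
    have "G - y n = (F - y n) * (1 - (\<Prod>i<n. m i) * t)"
      unfolding G_def by (simp only: left_diff_distrib right_diff_distrib mult_1_right) (simp add: ac_simps)
    also have "1 - (\<Prod>i<n. m i) * t = m n * s"
      by (simp only: st[symmetric] add_diff_cancel_right')
    finally show ?thesis using True by simp
  next
    case False
    with that have i: "i < n" by simp
    then have "m i dvd (\<Prod>i<n. m i)" by (intro dvd_prodI) simp_all
    then have "m i dvd (F - y i) + (\<Prod>i<n. m i) * (t * (y n - F))"
      using F i by (intro dvd_add dvd_mult2) auto
    then show ?thesis unfolding G_def by (simp only: add_diff_eq diff_add_eq)
  qed
  then show ?case by blast
qed

text \<open>This plays the role of the factorial in Goedel's moduli: it is divisible by every
  difference \<open>X^d - 1\<close> that can occur, and its constant coefficient is a unit.\<close>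

definition cyc_prod :: "nat \<Rightarrow> int poly" where
  "cyc_prod N = (\<Prod>d\<in>{1..N}. [:0, 1:] ^ d - 1)"

text \<open>Modulo both polynomials \<open>X\<^sup>i (X\<^bsup>j-i\<^esup> - 1)\<close> vanishes, hence so do \<open>X\<^sup>i cyc_prod N\<close> and
  \<open>X\<^bsup>2i\<^esup>\<close>; but \<open>X\<close> is comaximal with \<open>cyc_prod N - X\<^sup>i\<close>, whose constant coefficient is \<open>\<plusminus>1\<close>.\<close>

lemma comax_cyc_prod:
  assumes "0 < i" "i < j" "j - i \<le> N"
  shows "comax (cyc_prod N - [:0, 1:] ^ i) (cyc_prod N - [:0, 1:] ^ j)"
proof -
  define X where "X = ([:0, 1:] :: int poly)"
  define h where "h = cyc_prod N"
  define d where "d = j - i"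
  have "X ^ d - 1 dvd h"
    unfolding h_def cyc_prod_def X_def by (intro dvd_prodI) (use assms in \<open>auto simp: d_def\<close>)
  then obtain q where q: "h = (X ^ d - 1) * q" by (auto simp: dvd_def)
  have j: "X ^ j = X ^ i * X ^ d"
    using assms by (simp add: d_def flip: power_add)
  have "poly h 0 = (\<Prod>d\<in>{1..N}. - 1)"
    unfolding h_def cyc_prod_def poly_prod by (intro prod.cong) (auto simp: poly_power zero_power)
  then have "(poly h 0)\<^sup>2 = 1" by (simp flip: power_mult add: mult.commute)
  then have h0: "poly (h - X ^ i) 0 * poly (h - X ^ i) 0 = 1"
    using assms by (simp add: X_def poly_power zero_power power2_eq_square)
  obtain c r where cr: "h - X ^ i = pCons c r" by (cases "h - X ^ i")
  have cc1: "c * c = 1" using h0 unfolding cr by simp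
  have cc2: "h - X ^ i = [:c:] + X * r" unfolding cr by (simp add: X_def)
  \<comment> \<open>The constant coefficient \<open>c\<close> is its own inverse; working with its
    square avoids tracking the sign.\<close>
  have "(h - X ^ i) * [:c:] + X * (- r * [:c:]) = [:c:] * [:c:]"
    unfolding cc2 by (simp only: algebra_simps mult_minus_left mult_minus_right)
  also have "\<dots> = 1" by (simp add: cc1 one_pCons)
  finally have "(h - X ^ i) * [:c:] + X * (- r * [:c:]) = 1" .
  then have "comax (h - X ^ i) X" unfolding comax_def by blast
  then obtain s t where st: "(h - X ^ i) * s + X ^ (i + i) * t = 1"
    using comax_power unfolding comax_def by blast
  \<comment> \<open>With \<open>X^i\<close> for \<open>a\<close> and \<open>X^d\<close> for
    \<open>b\<close>, the term \<open>(b - 1) * q\<close> is \<open>h\<close>: an explicit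
    certificate that the ideal of the two moduli contains \<open>X^(2i)\<close>.\<close>
  have "a * a = (q - a) * ((b - 1) * q - a) + ((b - 1) * q - a * b) * (- q)" for a b :: "int poly"
    by (simp add: algebra_simps)
  then have "X ^ (i + i) = (q - X ^ i) * (h - X ^ i) + (h - X ^ j) * (- q)"
    unfolding j q power_add .
  moreover have "a * (s + c * t) + b * (- q * t) = a * s + (c * a + b * (- q)) * t"
    for a b c :: "int poly"
    by (simp add: algebra_simps)
  ultimately have "(h - X ^ i) * (s + (q - X ^ i) * t) + (h - X ^ j) * (- q * t)
      = (h - X ^ i) * s + X ^ (i + i) * t"
    by metis
  also note st
  finally have "(h - X ^ i) * (s + (q - X ^ i) * t) + (h - X ^ j) * (- q * t) = 1" .
  then have "comax (h - X ^ i) (h - X ^ j)" unfolding comax_def by blast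
  then show ?thesis by (simp only: h_def X_def)
qed

section \<open>Evaluation of integer polynomials in a noncommutative ring\<close>

text \<open>Integers are central and powers of \<open>p\<close> commute with each other, so
  evaluation is a homomorphism even in a noncommutative ring. It carries divisibilities from Z[X] to
  coefficients of any characteristic.\<close>

definition int_eval :: "'a::ring_1 \<Rightarrow> int poly \<Rightarrow> 'a" where
  "int_eval p F = fold_coeffs (\<lambda>a b. of_int a + p * b) F 0"

lemma int_eval_0 [simp]: "int_eval p 0 = 0"
  by (simp add: int_eval_def)

lemma int_eval_pCons [simp]: "int_eval p (pCons a F) = of_int a + p * int_eval p F"
  by (cases "F = 0 \<and> a = 0") (auto simp: int_eval_def)

lemma int_eval_1 [simp]: "int_eval p 1 = 1"
  by (simp add: one_pCons)

lemma int_eval_add [simp]: "int_eval p (F + G) = int_eval p F + int_eval p G"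
  by (induction F G rule: poly_induct2) (simp_all add: algebra_simps)

lemma int_eval_minus [simp]: "int_eval p (- F) = - int_eval p F"
  by (induction F) (simp_all add: algebra_simps)

lemma int_eval_diff [simp]: "int_eval p (F - G) = int_eval p F - int_eval p G"
  using int_eval_add[of p F "- G"] by simp

lemma int_eval_smult [simp]: "int_eval p (smult a F) = of_int a * int_eval p F"
proof (induction F)
  case (pCons b F)
  have "p * (of_int a * int_eval p F) = of_int a * (p * int_eval p F)"
    by (metis mult.assoc mult_of_int_commute)
  with pCons show ?case by (simp add: distrib_left)
qed simp

lemma int_eval_mult [simp]: "int_eval p (F * G) = int_eval p F * int_eval p G"
  by (induction F) (simp_all add: distrib_left distrib_right mult.assoc)

lemma int_eval_X_power [simp]: "int_eval p ([:0, 1:] ^ n) = p ^ n"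
  by (induction n) simp_all

section \<open>Powers of a parameter in a graded domain\<close>

text \<open>These are the only properties of the free algebra that the undecidability argument uses.
  \<open>C\<close> is a subset of the type because words are formed over a whole type of letters, of
  which \<open>X\<close> may be a part.\<close>

locale graded_domain =
  fixes C :: "'a::ring_1 set" and deg :: "'a \<Rightarrow> nat"
  assumes zero_closed [simp, intro]: "0 \<in> C"
    and one_closed [simp, intro]: "1 \<in> C"
    and add_closed [simp, intro]: "a \<in> C \<Longrightarrow> b \<in> C \<Longrightarrow> a + b \<in> C"
    and uminus_closed [simp, intro]: "a \<in> C \<Longrightarrow> - a \<in> C"
    and mult_closed [simp, intro]: "a \<in> C \<Longrightarrow> b \<in> C \<Longrightarrow> a * b \<in> C"
    and no_zero_divisors: "a * b = 0 \<Longrightarrow> (a::'a) = 0 \<or> b = 0"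
    and deg_mult: "a \<noteq> 0 \<Longrightarrow> b \<noteq> 0 \<Longrightarrow> deg (a * b) = deg a + deg b"
    and deg_add: "deg (a + b) \<le> max (deg a) (deg b)"
    and deg_0_unit: "a \<in> C \<Longrightarrow> a \<noteq> 0 \<Longrightarrow> deg a = 0 \<Longrightarrow> \<exists>w\<in>C. a * w = 1"
begin

lemma mult_eq_0_iff' [simp]: "a * b = 0 \<longleftrightarrow> (a::'a) = 0 \<or> b = 0"
  using no_zero_divisors[of a b] by auto

lemma diff_closed [simp, intro]: "a \<in> C \<Longrightarrow> b \<in> C \<Longrightarrow> a - b \<in> C"
  using add_closed[of a "- b"] by simp

lemma power_closed [simp, intro]: "a \<in> C \<Longrightarrow> a ^ n \<in> C"
  by (induction n) simp_all

lemma of_int_closed [simp, intro]: "of_int k \<in> C"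
proof -
  have "of_nat n \<in> C" for n
    by (induction n) simp_all
  then show ?thesis
    by (cases k rule: int_cases2) (auto intro: uminus_closed)
qed

lemma int_eval_closed [simp, intro]: "p \<in> C \<Longrightarrow> int_eval p F \<in> C"
  by (induction F) simp_all

lemma deg_1 [simp]: "deg 1 = 0"
  using deg_mult[of 1 1] by simp

lemma deg_uminus [simp]: "deg (- a) = deg a"
proof (cases "a = 0")
  case False
  have "deg (- 1) = 0" using deg_mult[of "- 1" "- 1"] by simp
  with False show ?thesis using deg_mult[of "- 1" a] by simp
qed simp

lemma deg_0 [simp]: "deg 0 = 0"
  using deg_add[of 1 "- 1"] by simp

lemma deg_diff: "deg (a - b) \<le> max (deg a) (deg b)"
  using deg_add[of a "- b"] by simp

lemma deg_diff_eq:
  assumes "deg b < deg a"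
  shows "deg (a - b) = deg a"
proof (rule antisym)
  show "deg (a - b) \<le> deg a" using deg_diff[of a b] assms by simp
  show "deg a \<le> deg (a - b)" using deg_add[of "a - b" b] assms by simp
qed

lemma power_nonzero: "(a::'a) \<noteq> 0 \<Longrightarrow> a ^ n \<noteq> 0"
  by (induction n) simp_all

lemma deg_power: "a \<noteq> 0 \<Longrightarrow> deg (a ^ n) = n * deg a"
  by (induction n) (simp_all add: deg_mult power_nonzero)

lemma geometric_sum_ex:
  assumes "p \<in> C"
  shows "\<exists>s\<in>C. p ^ n - 1 = (p - 1) * s"
proof (induction n)
  case (Suc n)
  then obtain s where s: "s \<in> C" "p ^ n - 1 = (p - 1) * s" by blast
  have "p ^ Suc n - 1 = (p ^ n - 1) + (p - 1) * p ^ n"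
    by (simp add: algebra_simps)
  also have "\<dots> = (p - 1) * (s + p ^ n)"
    by (simp only: s distrib_left)
  finally show ?case using s(1) assms by blast
qed (auto intro: bexI[of _ 0])

section \<open>First-order recognition of the powers of a parameter\<close>

definition pdivs :: "'a \<Rightarrow> 'a \<Rightarrow> bool" where
  "pdivs p b \<longleftrightarrow> (\<forall>d\<in>C. \<forall>e\<in>C. d * e = b \<longrightarrow> (\<exists>w\<in>C. e * w = 1) \<or> (\<exists>g\<in>C. e = p * g))"

lemma pdivsD:
  "pdivs p b \<Longrightarrow> d \<in> C \<Longrightarrow> e \<in> C \<Longrightarrow> d * e = b \<Longrightarrow> (\<exists>w\<in>C. e * w = 1) \<or> (\<exists>g\<in>C. e = p * g)"
  unfolding pdivs_def by blast

text \<open>The divisor condition alone determines a power only up to a unit factor. The first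
  conjunct, \<open>b - 1 = (p - 1) * u\<close> written without subtraction, removes that
  factor.\<close>

definition pow :: "'a \<Rightarrow> 'a \<Rightarrow> bool" where
  "pow p b \<longleftrightarrow> (\<exists>u\<in>C. b + u = 1 + p * u) \<and> pdivs p b"

text \<open>The first two clauses force positive degree, whence whatever satisfies
  \<open>pow\<close> is a power. The last clause is the induction step for the converse.\<close>

definition good :: "'a \<Rightarrow> bool" where
  "good p \<longleftrightarrow> p \<noteq> 0 \<and> \<not> (\<exists>w\<in>C. p * w = 1) \<and> (\<forall>b\<in>C. pow p b \<longrightarrow> pow p (p * b))"

lemma deg_right_unit: "a * w = 1 \<Longrightarrow> deg a = 0"
  using deg_mult[of a w] by (cases "a = 0 \<or> w = 0") auto

text \<open>With \<open>d = 1\<close> the condition says that \<open>b\<close> is a unit or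
  \<open>p * g\<close>. Since it speaks of right factors, it passes from \<open>b\<close> to
  \<open>g\<close>, whose degree is smaller.\<close>

lemma pdivs_imp_power_times_unit:
  assumes "p \<in> C" "p \<noteq> 0" "deg p > 0"
  shows "b \<in> C \<Longrightarrow> b \<noteq> 0 \<Longrightarrow> pdivs p b \<Longrightarrow> \<exists>n. \<exists>c\<in>C. b = p ^ n * c \<and> (\<exists>w\<in>C. c * w = 1)"
proof (induction "deg b" arbitrary: b rule: less_induct)
  case less
  have "(\<exists>w\<in>C. b * w = 1) \<or> (\<exists>g\<in>C. b = p * g)"
    by (rule pdivsD[OF less.prems(3) one_closed less.prems(1) mult_1_left])
  then show ?case
  proof
    assume "\<exists>w\<in>C. b * w = 1"
    moreover have "b = p ^ 0 * b" by simp
    ultimately show ?thesis using less.prems(1) by blast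
  next
    assume "\<exists>g\<in>C. b = p * g"
    then obtain g where g: "g \<in> C" "b = p * g" by blast
    with less.prems have g0: "g \<noteq> 0" by auto
    have "deg g < deg b" using g g0 assms by (simp add: deg_mult)
    moreover have "pdivs p g"
      unfolding pdivs_def
    proof (intro ballI impI)
      fix d e assume de: "d \<in> C" "e \<in> C" "d * e = g"
      then have "(p * d) * e = b" by (simp add: g mult.assoc)
      then show "(\<exists>w\<in>C. e * w = 1) \<or> (\<exists>g\<in>C. e = p * g)"
        using pdivsD[OF less.prems(3)] mult_closed[OF assms(1) de(1)] de(2) by blast
    qed
    ultimately obtain n c where "c \<in> C" "g = p ^ n * c" "\<exists>w\<in>C. c * w = 1"
      using less.hyps g g0 by blast
    moreover from this have "b = p ^ Suc n * c" using g by (simp add: mult.assoc)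
    ultimately show ?thesis by blast
  qed
qed

text \<open>Write \<open>b = p^n * c\<close> with \<open>c\<close> a unit. Both \<open>b\<close> and
  \<open>p^n\<close> are 1 modulo \<open>p - 1\<close>, hence so is \<open>c\<close>; but
  \<open>c - 1\<close> has degree 0 and a nonzero right multiple of \<open>p - 1\<close> has
  positive degree.\<close>

lemma pow_imp_power:
  assumes p: "p \<in> C" "p \<noteq> 0" "deg p > 0" and b: "b \<in> C" "pow p b"
  shows "\<exists>n. b = p ^ n"
proof -
  obtain u where u: "u \<in> C" "b + u = 1 + p * u" using b unfolding pow_def by blast
  have "deg (p - 1) > 0" using deg_diff_eq[of 1 p] p by simp
  then have no_unit: "(p - 1) * v \<noteq> 1" for v
    using deg_right_unit[of "p - 1" v] by auto
  have p1: "p - 1 \<noteq> 0" using p by auto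
  have bu: "b - 1 = (p - 1) * u" using u by (simp add: algebra_simps)
  have "b \<noteq> 0"
  proof
    assume "b = 0"
    with bu have "(p - 1) * (- u) = 1" by (metis add.inverse_inverse diff_0 mult_minus_right)
    with no_unit show False by blast
  qed
  then obtain n c w where c: "c \<in> C" "b = p ^ n * c" "c * w = 1"
    using pdivs_imp_power_times_unit[OF p b(1)] b(2) unfolding pow_def by blast
  obtain s where s: "s \<in> C" "p ^ n - 1 = (p - 1) * s"
    using geometric_sum_ex p by blast
  have "c - 1 = (b - 1) - (p ^ n - 1) * c" by (simp add: c left_diff_distrib)
  also have "\<dots> = (p - 1) * (u - s * c)" by (simp only: bu s right_diff_distrib mult.assoc)
  finally have c1: "c - 1 = (p - 1) * (u - s * c)" .
  have "deg (c - 1) = 0" using deg_diff[of c 1] deg_right_unit[OF c(3)] by simp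
  with c1 have "u - s * c = 0"
    using deg_mult[OF p1, of "u - s * c"] \<open>deg (p - 1) > 0\<close> by auto
  with c1 have "c = 1" by simp
  with c show ?thesis by auto
qed

lemma pow_one:
  assumes "p \<in> C"
  shows "pow p 1"
proof -
  have "pdivs p 1"
    unfolding pdivs_def
  proof (intro ballI impI disjI1)
    fix d e assume e: "e \<in> C" "d * e = 1"
    then have "d \<noteq> 0" "e \<noteq> 0" by auto
    with e have "deg e = 0" using deg_mult[of d e] by simp
    then show "\<exists>w\<in>C. e * w = 1" using e \<open>e \<noteq> 0\<close> by (intro deg_0_unit)
  qed
  moreover have "\<exists>u\<in>C. 1 + u = 1 + p * u" by (rule bexI[of _ 0]) simp_all
  ultimately show ?thesis unfolding pow_def by blast
qed

lemma good_deg: "p \<in> C \<Longrightarrow> good p \<Longrightarrow> deg p > 0"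
  using deg_0_unit[of p] by (cases "deg p = 0") (simp_all add: good_def)

lemma good_nonzero: "good p \<Longrightarrow> p \<noteq> 0"
  by (simp add: good_def)

lemma good_pow_power:
  assumes p: "p \<in> C" "good p"
  shows "pow p (p ^ n)"
proof (induction n)
  case 0
  then show ?case using p pow_one by simp
next
  case (Suc n)
  have "\<forall>b\<in>C. pow p b \<longrightarrow> pow p (p * b)" using p(2) by (simp add: good_def)
  from bspec[OF this power_closed[OF p(1)]] Suc show ?case by simp
qed

lemma pow_iff_power:
  assumes "p \<in> C" "good p" "b \<in> C"
  shows "pow p b \<longleftrightarrow> (\<exists>n. b = p ^ n)"
  using pow_imp_power[OF assms(1) good_nonzero[OF assms(2)] good_deg[OF assms(1,2)] assms(3)]
    good_pow_power[OF assms(1,2)] by blast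

lemma good_power_inject:
  assumes "p \<in> C" "good p" "p ^ m = p ^ n"
  shows "m = n"
proof -
  have "m * deg p = n * deg p"
    using deg_power[OF good_nonzero[OF assms(2)]] assms(3) by metis
  then show ?thesis using good_deg[of p] assms by simp
qed

section \<open>Coding finite sequences\<close>

text \<open>This is \<open>F - p^b = (h - p^(i+1)) * u\<close> without subtraction. The shift to
  \<open>i + 1\<close> matters: comaximality needs a positive exponent, since otherwise the constant
  coefficient of the modulus is no longer a unit.\<close>

definition congr :: "'a \<Rightarrow> 'a \<Rightarrow> 'a \<Rightarrow> nat \<Rightarrow> nat \<Rightarrow> bool" where
  "congr p F h i b \<longleftrightarrow> (\<exists>u\<in>C. F + p * p ^ i * u = p ^ b + h * u)"

definition beta :: "'a \<Rightarrow> 'a \<Rightarrow> 'a \<Rightarrow> nat \<Rightarrow> nat \<Rightarrow> bool" where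
  "beta p F h i b \<longleftrightarrow> congr p F h i b \<and> (\<forall>c<b. \<not> congr p F h i c)"

lemma beta_unique: "beta p F h i b \<Longrightarrow> beta p F h i c \<Longrightarrow> b = c"
  unfolding beta_def by (meson linorder_neqE_nat)

lemma deg_cyc_prod:
  assumes "p \<noteq> 0" "deg p > 0"
  shows "int_eval p (cyc_prod N) \<noteq> 0 \<and> N * deg p \<le> deg (int_eval p (cyc_prod N))"
proof (induction N)
  case 0
  then show ?case by (simp add: cyc_prod_def)
next
  case (Suc N)
  have d: "deg (p ^ Suc N - 1) = Suc N * deg p"
    using assms deg_diff_eq[of 1 "p ^ Suc N"] deg_power[of p "Suc N"] by simp
  with assms have nz: "p ^ Suc N - 1 \<noteq> 0" by auto
  have "cyc_prod (Suc N) = cyc_prod N * ([:0, 1:] ^ Suc N - 1)"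
    by (simp add: cyc_prod_def)
  then have e: "int_eval p (cyc_prod (Suc N)) = int_eval p (cyc_prod N) * (p ^ Suc N - 1)"
    by (simp only: int_eval_mult int_eval_diff int_eval_X_power int_eval_1)
  show ?case unfolding e using Suc.IH nz d by (simp add: deg_mult del: power_Suc)
qed

text \<open>The Chinese remainder theorem in Z[X], evaluated at \<open>p\<close>, supplies the
  congruences. Minimality is a degree count: if a smaller \<open>b\<close> also worked,
  \<open>p^(a i) - p^b\<close> would be a nonzero right multiple of the modulus, whose degree is
  that of \<open>h\<close> and hence too large.\<close>

lemma beta_exists:
  assumes p: "p \<in> C" "good p"
  shows "\<exists>F\<in>C. \<exists>h\<in>C. \<forall>i<n. beta p F h i (a i)"
proof -
  define X where "X = ([:0, 1:] :: int poly)"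
  \<comment> \<open>Large enough that \<open>cyc_prod N\<close> contains \<open>X^(j-i) - 1\<close>
    for any two moduli, and that \<open>p^(i+1)\<close> and \<open>p^(a i)\<close> have smaller
    degree than \<open>h\<close>.\<close>
  define N where "N = Suc n + (\<Sum>i<n. a i)"
  define h where "h = int_eval p (cyc_prod N)"
  have p0: "p \<noteq> 0" and dp: "deg p > 0" using p good_deg good_nonzero by simp_all
  have dh: "N * deg p \<le> deg h"
    using deg_cyc_prod[OF p0 dp] unfolding h_def by blast
  have "comax (cyc_prod N - X ^ Suc i) (cyc_prod N - X ^ Suc j)" if "i < j" "j < n" for i j
    unfolding X_def by (rule comax_cyc_prod) (use that in \<open>simp_all add: N_def\<close>)
  from chinese_remainder_comax[OF this]
  obtain F where F: "\<forall>i<n. cyc_prod N - X ^ Suc i dvd F - X ^ a i" ..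
  have "beta p (int_eval p F) h i (a i)" if i: "i < n" for i
  proof -
    obtain q where "F - X ^ a i = (cyc_prod N - X ^ Suc i) * q"
      using F i by (auto simp: dvd_def)
    then have "int_eval p (F - X ^ a i) = int_eval p ((cyc_prod N - X ^ Suc i) * q)" by simp
    then have q: "int_eval p F - p ^ a i = (h - p ^ Suc i) * int_eval p q"
      by (simp only: int_eval_mult int_eval_diff int_eval_X_power X_def h_def)
    then have "int_eval p F + p * p ^ i * int_eval p q = p ^ a i + h * int_eval p q"
      by (simp add: algebra_simps)
    then have "congr p (int_eval p F) h i (a i)"
      unfolding congr_def using p by blast
    moreover have "\<not> congr p (int_eval p F) h i b" if b: "b < a i" for b
    proof
      assume "congr p (int_eval p F) h i b"
      then obtain u where "int_eval p F + p * p ^ i * u = p ^ b + h * u"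
        unfolding congr_def by blast
      then have u: "int_eval p F - p ^ b = (h - p ^ Suc i) * u"
        by (simp add: algebra_simps)
      have "p ^ a i - p ^ b = (int_eval p F - p ^ b) - (int_eval p F - p ^ a i)" by simp
      also have "\<dots> = (h - p ^ Suc i) * (u - int_eval p q)"
        by (simp only: u q right_diff_distrib)
      finally have e: "p ^ a i - p ^ b = (h - p ^ Suc i) * (u - int_eval p q)" .
      have da: "deg (p ^ a i - p ^ b) = a i * deg p"
        using deg_diff_eq[of "p ^ b" "p ^ a i"] b dp p0 by (simp add: deg_power)
      then have nz: "p ^ a i - p ^ b \<noteq> 0"
        using good_power_inject[OF p, of "a i" b] b by auto
      have "Suc i < N" using i by (simp add: N_def)
      then have "Suc i * deg p < N * deg p" using dp by (rule mult_less_mono1)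
      then have dm: "deg (h - p ^ Suc i) = deg h"
        using dh by (intro deg_diff_eq) (simp only: deg_power[OF p0] order_less_le_trans)
      have "deg h \<le> deg (p ^ a i - p ^ b)"
        using nz deg_mult[of "h - p ^ Suc i" "u - int_eval p q"] unfolding e mult_eq_0_iff' de_Morgan_disj
        by (simp only: dm) simp
      moreover have "a i < N"
        using member_le_sum[of i "{..<n}" a] i by (simp add: N_def)
      then have "a i * deg p < N * deg p" using dp by (rule mult_less_mono1)
      ultimately show False using dh da by simp
    qed
    ultimately show ?thesis unfolding beta_def by blast
  qed
  then show ?thesis using p by (intro bexI[of _ "int_eval p F"] bexI[of _ h]) (auto simp: h_def)
qed

end

section \<open>Programs as relations\<close>

lemma computes_RZero_iff: "computes RZero xs y \<longleftrightarrow> y = 0"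
  by (auto intro: computes.intros elim: computes.cases)

lemma computes_RSucc_iff: "computes RSucc xs y \<longleftrightarrow> (\<exists>x xs'. xs = x # xs' \<and> y = Suc x)"
  by (auto intro: computes.intros elim: computes.cases)

lemma computes_RProj_iff: "computes (RProj i) xs y \<longleftrightarrow> i < length xs \<and> y = xs ! i"
  by (auto intro: computes.intros elim: computes.cases)

lemma computes_RComp_iff:
  "computes (RComp f gs) xs y \<longleftrightarrow> (\<exists>ys. list_all2 (\<lambda>g y. computes g xs y) gs ys \<and> computes f ys y)"
  by (auto intro: computes.intros elim: computes.cases)

lemma computes_RMu_iff:
  "computes (RMu f) xs n \<longleftrightarrow> computes f (n # xs) 0 \<and> (\<forall>m<n. \<exists>y. computes f (m # xs) (Suc y))"
  by (auto intro: computes.intros elim: computes.cases)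

lemma computes_RPrim_0_iff: "computes (RPrim f g) (0 # xs) y \<longleftrightarrow> computes f xs y"
  by (auto intro: computes.intros elim: computes.cases)

lemma computes_RPrim_Suc_iff:
  "computes (RPrim f g) (Suc n # xs) y \<longleftrightarrow>
    (\<exists>r. computes (RPrim f g) (n # xs) r \<and> computes g (n # r # xs) y)"
  by (auto intro: computes.intros elim: computes.cases)

lemma computes_RPrim_Nil: "\<not> computes (RPrim f g) [] y"
  by (auto elim: computes.cases)

text \<open>The recursion is unfolded into its history \<open>a\<close>, whose first
  \<open>n + 1\<close> values are what \<open>beta\<close> can encode.\<close>

lemma computes_RPrim_iff:
  "computes (RPrim f g) (n # xs) y \<longleftrightarrow>
    (\<exists>a. computes f xs (a 0) \<and> (\<forall>k<n. computes g (k # a k # xs) (a (Suc k))) \<and> a n = y)"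
proof (induction n arbitrary: y)
  case 0
  show ?case unfolding computes_RPrim_0_iff by (auto intro: exI[of _ "\<lambda>_. y"])
next
  case (Suc n)
  show ?case
  proof
    assume "computes (RPrim f g) (Suc n # xs) y"
    then obtain r a where "computes f xs (a 0)" "\<forall>k<n. computes g (k # a k # xs) (a (Suc k))"
      "a n = r" "computes g (n # r # xs) y"
      unfolding computes_RPrim_Suc_iff Suc by blast
    then show "\<exists>a. computes f xs (a 0) \<and>
        (\<forall>k<Suc n. computes g (k # a k # xs) (a (Suc k))) \<and> a (Suc n) = y"
      by (intro exI[of _ "a(Suc n := y)"]) (auto simp: less_Suc_eq)
  next
    assume "\<exists>a. computes f xs (a 0) \<and>
        (\<forall>k<Suc n. computes g (k # a k # xs) (a (Suc k))) \<and> a (Suc n) = y"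
    then show "computes (RPrim f g) (Suc n # xs) y"
      unfolding computes_RPrim_Suc_iff Suc by (metis lessI less_SucI)
  qed
qed

section \<open>Formulas about powers of the parameter\<close>

definition Disj :: "fm \<Rightarrow> fm \<Rightarrow> fm" where
  "Disj \<phi> \<psi> = Neg (Conj (Neg \<phi>) (Neg \<psi>))"

definition Imp :: "fm \<Rightarrow> fm \<Rightarrow> fm" where
  "Imp \<phi> \<psi> = Neg (Conj \<phi> (Neg \<psi>))"

definition All :: "nat \<Rightarrow> fm \<Rightarrow> fm" where
  "All i \<phi> = Neg (Exists i (Neg \<phi>))"

lemma sat_Disj [simp]: "sat R e (Disj \<phi> \<psi>) \<longleftrightarrow> sat R e \<phi> \<or> sat R e \<psi>"
  by (simp add: Disj_def)

lemma sat_Imp [simp]: "sat R e (Imp \<phi> \<psi>) \<longleftrightarrow> (sat R e \<phi> \<longrightarrow> sat R e \<psi>)"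
  by (simp add: Imp_def)

lemma sat_All [simp]: "sat R e (All i \<phi>) \<longleftrightarrow> (\<forall>a\<in>carrier R. sat R (e(i := a)) \<phi>)"
  by (simp add: All_def)

lemma free_vars_derived [simp]:
  "free_vars (Disj \<phi> \<psi>) = free_vars \<phi> \<union> free_vars \<psi>"
  "free_vars (Imp \<phi> \<psi>) = free_vars \<phi> \<union> free_vars \<psi>"
  "free_vars (All i \<phi>) = free_vars \<phi> - {i}"
  by (simp_all add: Disj_def Imp_def All_def)

text \<open>Variable \<open>0\<close> always holds the parameter \<open>p\<close>.\<close>

definition pow_fm :: "nat \<Rightarrow> fm" where
  "pow_fm k = Conj
    (Exists (k + 1) (Eq (Add (Var k) (Var (k + 1))) (Add One (Mul (Var 0) (Var (k + 1))))))
    (All (k + 1) (All (k + 2) (Imp (Eq (Mul (Var (k + 1)) (Var (k + 2))) (Var k))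
      (Disj (Exists (k + 3) (Eq (Mul (Var (k + 2)) (Var (k + 3))) One))
        (Exists (k + 3) (Eq (Var (k + 2)) (Mul (Var 0) (Var (k + 3)))))))))"

text \<open>\<open>pow_fm 1\<close> rebinds variable 2 internally; this is harmless, as only 0 and 1
  are free in it.\<close>

definition good_fm :: fm where
  "good_fm = Conj (Neg (Eq (Var 0) Zero)) (Conj (Neg (Exists 1 (Eq (Mul (Var 0) (Var 1)) One)))
    (All 1 (All 2 (Imp (Conj (Eq (Var 2) (Mul (Var 0) (Var 1))) (pow_fm 1)) (pow_fm 2)))))"

lemma free_vars_pow_fm: "free_vars (pow_fm k) = {0, k}"
  by (auto simp: pow_fm_def)

lemma free_vars_good_fm: "free_vars good_fm = {0}"
  by (auto simp: good_fm_def free_vars_pow_fm)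

text \<open>Number variables start at 4 and are stored as powers of \<open>p\<close>. Slot 3 is
  scratch space for the witness in \<open>congr\<close>; giving it a place of its own keeps every
  updated assignment in this form.\<close>

definition env :: "'a::monoid_mult \<Rightarrow> 'a \<Rightarrow> 'a \<Rightarrow> 'a \<Rightarrow> (nat \<Rightarrow> nat) \<Rightarrow> nat \<Rightarrow> 'a" where
  "env p F h u s i = (if i = 0 then p else if i = 1 then F else if i = 2 then h
    else if i = 3 then u else p ^ s (i - 4))"

lemma env_simps [simp]:
  "env p F h u s 0 = p" "env p F h u s (Suc 0) = F" "env p F h u s 2 = h" "env p F h u s 3 = u"
  "env p F h u s (i + 4) = p ^ s i"
  by (simp_all add: env_def)

lemma env_update:
  "(env p F h u s)(1 := F') = env p F' h u s"
  "(env p F h u s)(2 := F') = env p F F' u s"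
  "(env p F h u s)(3 := F') = env p F h F' s"
  "(env p F h u s)(k + 4 := p ^ n) = env p F h u (s(k := n))"
  by (auto simp: env_def fun_eq_iff)

section \<open>Relations on exponents definable uniformly in the parameter\<close>

context graded_domain
begin

definition alg :: "'a ring" where
  "alg = \<lparr>carrier = C, monoid.mult = (*), one = 1, zero = 0, add = (+)\<rparr>"

lemma alg_simps [simp]:
  "carrier alg = C" "a \<otimes>\<^bsub>alg\<^esub> b = a * b" "\<one>\<^bsub>alg\<^esub> = 1" "\<zero>\<^bsub>alg\<^esub> = 0" "a \<oplus>\<^bsub>alg\<^esub> b = a + b"
  by (simp_all add: alg_def)

lemma sat_pow_fm [simp]: "0 < k \<Longrightarrow> sat alg e (pow_fm k) \<longleftrightarrow> pow (e 0) (e k)"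
  by (simp add: pow_fm_def pow_def pdivs_def)

lemma sat_good_fm: "e 0 \<in> C \<Longrightarrow> sat alg e good_fm \<longleftrightarrow> good (e 0)"
  by (simp add: good_fm_def good_def)

definition definable :: "('a \<Rightarrow> 'a \<Rightarrow> 'a \<Rightarrow> (nat \<Rightarrow> nat) \<Rightarrow> bool) \<Rightarrow> bool" where
  "definable Q \<longleftrightarrow> (\<exists>\<phi>. \<forall>p F h u s. p \<in> C \<longrightarrow> good p \<longrightarrow> F \<in> C \<longrightarrow> h \<in> C \<longrightarrow> u \<in> C \<longrightarrow>
    (sat alg (env p F h u s) \<phi> \<longleftrightarrow> Q p F h s))"

lemma definableI:
  assumes "\<And>p F h u s. p \<in> C \<Longrightarrow> good p \<Longrightarrow> F \<in> C \<Longrightarrow> h \<in> C \<Longrightarrow> u \<in> C \<Longrightarrow>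
    sat alg (env p F h u s) \<phi> \<longleftrightarrow> Q p F h s"
  shows "definable Q"
  unfolding definable_def using assms by blast

lemma definableE:
  assumes "definable Q"
  obtains \<phi> where "\<And>p F h u s. p \<in> C \<Longrightarrow> good p \<Longrightarrow> F \<in> C \<Longrightarrow> h \<in> C \<Longrightarrow> u \<in> C \<Longrightarrow>
    sat alg (env p F h u s) \<phi> \<longleftrightarrow> Q p F h s"
  using assms unfolding definable_def by blast

lemma definable_cong:
  assumes "definable Q"
    and "\<And>p F h s. p \<in> C \<Longrightarrow> good p \<Longrightarrow> Q p F h s \<longleftrightarrow> Q' p F h s"
  shows "definable Q'"
  using assms by (elim definableE) (rule definableI, simp)

lemma definable_const: "definable (\<lambda>_ _ _ _. b)"
  by (rule definableI[where \<phi> = "if b then Eq Zero Zero else Neg (Eq Zero Zero)"]) simp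

lemma definable_not:
  assumes "definable Q"
  shows "definable (\<lambda>p F h s. \<not> Q p F h s)"
proof -
  obtain \<phi> where \<phi>: "\<And>p F h u s. p \<in> C \<Longrightarrow> good p \<Longrightarrow> F \<in> C \<Longrightarrow> h \<in> C \<Longrightarrow> u \<in> C \<Longrightarrow>
    sat alg (env p F h u s) \<phi> \<longleftrightarrow> Q p F h s"
    by (rule definableE[OF assms]) (rule that)
  show ?thesis by (rule definableI[where \<phi> = "Neg \<phi>"]) (simp add: \<phi>)
qed

lemma definable_conj:
  assumes "definable Q" "definable Q'"
  shows "definable (\<lambda>p F h s. Q p F h s \<and> Q' p F h s)"
proof -
  obtain \<phi> where \<phi>: "\<And>p F h u s. p \<in> C \<Longrightarrow> good p \<Longrightarrow> F \<in> C \<Longrightarrow> h \<in> C \<Longrightarrow> u \<in> C \<Longrightarrow>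
    sat alg (env p F h u s) \<phi> \<longleftrightarrow> Q p F h s"
    by (rule definableE[OF assms(1)]) (rule that)
  obtain \<psi> where \<psi>: "\<And>p F h u s. p \<in> C \<Longrightarrow> good p \<Longrightarrow> F \<in> C \<Longrightarrow> h \<in> C \<Longrightarrow> u \<in> C \<Longrightarrow>
    sat alg (env p F h u s) \<psi> \<longleftrightarrow> Q' p F h s"
    by (rule definableE[OF assms(2)]) (rule that)
  show ?thesis by (rule definableI[where \<phi> = "Conj \<phi> \<psi>"]) (simp add: \<phi> \<psi>)
qed

lemma definable_ex_F:
  assumes "definable Q"
  shows "definable (\<lambda>p _ h s. \<exists>F\<in>C. Q p F h s)"
proof -
  obtain \<phi> where \<phi>: "\<And>p F h u s. p \<in> C \<Longrightarrow> good p \<Longrightarrow> F \<in> C \<Longrightarrow> h \<in> C \<Longrightarrow> u \<in> C \<Longrightarrow>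
    sat alg (env p F h u s) \<phi> \<longleftrightarrow> Q p F h s"
    by (rule definableE[OF assms]) (rule that)
  show ?thesis
    by (rule definableI[where \<phi> = "Exists 1 \<phi>"])
      (simp only: sat.simps alg_simps env_update \<phi> cong: bex_cong)
qed

lemma definable_ex_h:
  assumes "definable Q"
  shows "definable (\<lambda>p F _ s. \<exists>h\<in>C. Q p F h s)"
proof -
  obtain \<phi> where \<phi>: "\<And>p F h u s. p \<in> C \<Longrightarrow> good p \<Longrightarrow> F \<in> C \<Longrightarrow> h \<in> C \<Longrightarrow> u \<in> C \<Longrightarrow>
    sat alg (env p F h u s) \<phi> \<longleftrightarrow> Q p F h s"
    by (rule definableE[OF assms]) (rule that)
  show ?thesis
    by (rule definableI[where \<phi> = "Exists 2 \<phi>"])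
      (simp only: sat.simps alg_simps env_update \<phi> cong: bex_cong)
qed

lemma definable_ex:
  assumes "definable Q"
  shows "definable (\<lambda>p F h s. \<exists>n. Q p F h (s(k := n)))"
proof -
  obtain \<phi> where \<phi>: "\<And>p F h u s. p \<in> C \<Longrightarrow> good p \<Longrightarrow> F \<in> C \<Longrightarrow> h \<in> C \<Longrightarrow> u \<in> C \<Longrightarrow>
    sat alg (env p F h u s) \<phi> \<longleftrightarrow> Q p F h s"
    by (rule definableE[OF assms]) (rule that)
  show ?thesis
  proof (rule definableI[where \<phi> = "Exists (k + 4) (Conj (pow_fm (k + 4)) \<phi>)"])
    fix p F h u s
    assume p: "p \<in> C" "good p" and FC: "F \<in> C" "h \<in> C" "u \<in> C"
    let ?e = "env p F h u s"
    have "sat alg ?e (Exists (k + 4) (Conj (pow_fm (k + 4)) \<phi>)) \<longleftrightarrow>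
        (\<exists>b\<in>C. pow p b \<and> sat alg (?e(k + 4 := b)) \<phi>)"
      by simp
    also have "\<dots> \<longleftrightarrow> (\<exists>b\<in>C. (\<exists>n. b = p ^ n) \<and> sat alg (?e(k + 4 := b)) \<phi>)"
      by (rule bex_cong[OF refl]) (simp add: pow_iff_power[OF p])
    also have "\<dots> \<longleftrightarrow> (\<exists>n. sat alg (?e(k + 4 := p ^ n)) \<phi>)"
      using p by auto
    also have "\<dots> \<longleftrightarrow> (\<exists>n. Q p F h (s(k := n)))"
      by (simp only: env_update \<phi> p FC)
    finally show "sat alg ?e (Exists (k + 4) (Conj (pow_fm (k + 4)) \<phi>)) \<longleftrightarrow>
        (\<exists>n. Q p F h (s(k := n)))" .
  qed
qed

text \<open>Composition needs it: the number of intermediate results varies with the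
  program.\<close>

lemma definable_ex_finite:
  assumes "finite S" "definable Q"
  shows "definable (\<lambda>p F h s. \<exists>t. (\<forall>k. k \<notin> S \<longrightarrow> t k = s k) \<and> Q p F h t)"
  using assms
proof (induction S arbitrary: Q rule: finite_induct)
  case empty
  have "(\<exists>t. (\<forall>k. k \<notin> {} \<longrightarrow> t k = s k) \<and> P t) \<longleftrightarrow> P s" for P and s :: "nat \<Rightarrow> nat"
    by (auto simp flip: fun_eq_iff)
  then show ?case using empty by simp
next
  case (insert k S)
  show ?case
  proof (rule definable_cong[OF insert.IH[OF definable_ex[OF insert.prems, of k]]])
    fix p F h s
    show "(\<exists>t. (\<forall>i. i \<notin> S \<longrightarrow> t i = s i) \<and> (\<exists>n. Q p F h (t(k := n)))) \<longleftrightarrow>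
        (\<exists>t. (\<forall>i. i \<notin> insert k S \<longrightarrow> t i = s i) \<and> Q p F h t)" (is "?L \<longleftrightarrow> ?R")
    proof
      assume ?L
      then obtain t n where "\<forall>i. i \<notin> S \<longrightarrow> t i = s i" "Q p F h (t(k := n))" by blast
      then show ?R by (intro exI[of _ "t(k := n)"]) auto
    next
      assume ?R
      then obtain t where "\<forall>i. i \<notin> insert k S \<longrightarrow> t i = s i" "Q p F h t" by blast
      \<comment> \<open>Resetting \<open>k\<close> to \<open>s k\<close> restores agreement outside
        \<open>S\<close>; the inner quantifier then recovers \<open>t k\<close>.\<close>
      then show ?L by (intro exI[of _ "t(k := s k)"]) (auto intro: exI[of _ "t k"])
    qed
  qed
qed

lemma definable_all_less:
  "(\<And>k. k < l \<Longrightarrow> definable (Q k)) \<Longrightarrow> definable (\<lambda>p F h s. \<forall>k<l::nat. Q k p F h s)"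
proof (induction l)
  case 0
  then show ?case using definable_const[of True] by simp
next
  case (Suc l)
  then have "definable (\<lambda>p F h s. (\<forall>k<l. Q k p F h s) \<and> Q l p F h s)"
    by (intro definable_conj) simp_all
  then show ?case by (rule definable_cong) (auto simp: less_Suc_eq)
qed

lemma definable_eq_0: "definable (\<lambda>_ _ _ s. s i = 0)"
proof (rule definableI[where \<phi> = "Eq (Var (i + 4)) One"])
  fix p F h u s
  assume p: "p \<in> C" "good p"
  show "sat alg (env p F h u s) (Eq (Var (i + 4)) One) \<longleftrightarrow> s i = 0"
    using good_power_inject[OF p, of "s i" 0] by auto
qed

text \<open>The successor makes strict order the projection of this relation along
  \<open>k\<close>.\<close>

lemma definable_add: "definable (\<lambda>_ _ _ s. s i = s j + Suc (s k))"
proof (rule definableI[where \<phi> = "Eq (Var (i + 4)) (Mul (Var (j + 4)) (Mul (Var 0) (Var (k + 4))))"])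
  fix p F h u s
  assume p: "p \<in> C" "good p"
  show "sat alg (env p F h u s) (Eq (Var (i + 4)) (Mul (Var (j + 4)) (Mul (Var 0) (Var (k + 4)))))
      \<longleftrightarrow> s i = s j + Suc (s k)"
    using good_power_inject[OF p, of "s i" "s j + Suc (s k)"]
    by (auto simp only: sat.simps tm_val.simps env_simps alg_simps power_add power_Suc)
qed

lemma definable_eq: "definable (\<lambda>_ _ _ s. s i = s j)"
proof (rule definableI[where \<phi> = "Eq (Var (i + 4)) (Var (j + 4))"])
  fix p F h u s
  assume p: "p \<in> C" "good p"
  show "sat alg (env p F h u s) (Eq (Var (i + 4)) (Var (j + 4))) \<longleftrightarrow> s i = s j"
    using good_power_inject[OF p, of "s i" "s j"] by auto
qed

lemma definable_less: "definable (\<lambda>_ _ _ s. s i < s j)"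
  by (rule definable_cong[OF definable_ex[OF definable_add[of j i "Suc (i + j)"], of "Suc (i + j)"]])
    (simp add: less_iff_Suc_add)

lemma definable_Suc: "definable (\<lambda>_ _ _ s. s i = Suc (s j))"
proof (rule definableI[where \<phi> = "Eq (Var (i + 4)) (Mul (Var 0) (Var (j + 4)))"])
  fix p F h u s
  assume p: "p \<in> C" "good p"
  show "sat alg (env p F h u s) (Eq (Var (i + 4)) (Mul (Var 0) (Var (j + 4)))) \<longleftrightarrow> s i = Suc (s j)"
    using good_power_inject[OF p, of "s i" "Suc (s j)"] by auto
qed

lemma definable_congr: "definable (\<lambda>p F h s. congr p F h (s i) (s j))"
  by (rule definableI[where \<phi> = "Exists 3 (Eq (Add (Var 1) (Mul (Mul (Var 0) (Var (i + 4))) (Var 3)))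
      (Add (Var (j + 4)) (Mul (Var 2) (Var 3))))"])
    (simp only: sat.simps tm_val.simps alg_simps env_update env_simps One_nat_def congr_def)

lemma definable_beta: "definable (\<lambda>p F h s. beta p F h (s i) (s j))"
proof -
  let ?k = "Suc (i + j)"
  have "definable (\<lambda>p F h s. congr p F h (s i) (s j) \<and>
      \<not> (\<exists>c. (s(?k := c)) ?k < (s(?k := c)) j \<and> congr p F h ((s(?k := c)) i) ((s(?k := c)) ?k)))"
    by (intro definable_conj definable_not definable_congr definable_less
        definable_ex[where Q = "\<lambda>p F h s. s ?k < s j \<and> congr p F h (s i) (s ?k)"])
  then show ?thesis
    by (rule definable_cong) (auto simp: beta_def)
qed

section \<open>Definability of computable relations\<close>

text \<open>The induction is generalized over the argument variables \<open>is\<close> and the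
  result variable \<open>j\<close>, so that subprograms can be attached to fresh variables. Nested
  recursions may rebind \<open>F\<close> and \<open>h\<close>, because the defined relation ignores
  them.\<close>

lemma definable_computes: "definable (\<lambda>_ _ _ s. computes f (map s is) (s j))"
proof (induction f arbitrary: "is" j)
  case RZero
  show ?case by (simp add: computes_RZero_iff definable_eq_0)
next
  case RSucc
  show ?case
  proof (cases "is")
    case Nil
    then show ?thesis using definable_const[of False] by (simp add: computes_RSucc_iff)
  next
    case (Cons i is')
    then show ?thesis using definable_Suc[of j i] by (simp add: computes_RSucc_iff)
  qed
next
  case (RProj k)
  show ?case
    by (rule definable_cong[OF definable_conj[OF definable_const[of "k < length is"]
            definable_eq[of j "is ! k"]]]) (auto simp: computes_RProj_iff)
next
  case (RComp f gs)
  \<comment> \<open>All variables from \<open>m\<close> on are fresh; \<open>insert j\<close> also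
    keeps the set nonempty.\<close>
  define m where "m = Suc (Max (insert j (set is)))"
  have m: "j < m" "\<And>i. i \<in> set is \<Longrightarrow> i < m"
    unfolding m_def by (simp_all add: less_Suc_eq_le)
  define l where "l = length gs"
  let ?Q = "\<lambda>p F h s. (\<forall>k<l. computes (gs ! k) (map s is) (s (m + k))) \<and>
    computes f (map s [m..<m + l]) (s j)"
  have "definable (\<lambda>p F h s. \<exists>t. (\<forall>k. k \<notin> {m..<m + l} \<longrightarrow> t k = s k) \<and> ?Q p F h t)"
    by (intro definable_ex_finite definable_conj definable_all_less RComp.IH)
      (simp_all add: l_def)
  then show ?case
  proof (rule definable_cong)
    fix p F h and s :: "nat \<Rightarrow> nat"
    show "(\<exists>t. (\<forall>k. k \<notin> {m..<m + l} \<longrightarrow> t k = s k) \<and> ?Q p F h t) \<longleftrightarrow>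
        computes (RComp f gs) (map s is) (s j)" (is "?L \<longleftrightarrow> _")
    proof
      assume ?L
      then obtain t where t: "\<And>k. k \<notin> {m..<m + l} \<Longrightarrow> t k = s k" and Q: "?Q p F h t" by blast
      have "map t is = map s is" "t j = s j" using t m by (auto simp: not_le)
      with Q show "computes (RComp f gs) (map s is) (s j)"
        unfolding computes_RComp_iff
        by (intro exI[of _ "map t [m..<m + l]"]) (auto simp: list_all2_conv_all_nth l_def)
    next
      assume "computes (RComp f gs) (map s is) (s j)"
      then obtain ys where ys: "list_all2 (\<lambda>g y. computes g (map s is) y) gs ys"
        "computes f ys (s j)"
        unfolding computes_RComp_iff by blast
      define t where "t = (\<lambda>k. if k \<in> {m..<m + l} then ys ! (k - m) else s k)"
      have len: "length ys = l" using ys(1) by (simp add: l_def list_all2_lengthD)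
      have "map t is = map s is" "t j = s j" using m(1) by (auto simp: t_def dest: m(2))
      moreover have "map t [m..<m + l] = ys"
        by (rule nth_equalityI) (simp_all add: len t_def)
      moreover have "t (m + k) = ys ! k" if "k < l" for k using that by (simp add: t_def)
      ultimately have "?Q p F h t"
        using ys len by (simp add: list_all2_conv_all_nth l_def del: map_eq_conv)
      moreover have "\<forall>k. k \<notin> {m..<m + l} \<longrightarrow> t k = s k" by (simp add: t_def)
      ultimately show ?L by blast
    qed
  qed
next
  case (RPrim f g)
  show ?case
  proof (cases "is")
    case Nil
    then show ?thesis using definable_const[of False] by (simp add: computes_RPrim_Nil)
  next
    case (Cons i is')
    define m where "m = Suc (Max (insert j (set is)))"
    have "j < m" "\<forall>i\<in>set is. i < m"
      unfolding m_def by (simp_all add: less_Suc_eq_le)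
    then have m: "j < m" "i < m" "k \<notin> set is'" if "m \<le> k" for k
      using that by (auto simp: Cons)
    then have ij: "j < m" "i < m" by auto
    \<comment> \<open>\<open>beta\<close> takes its index from a variable, so even the index 0 has
      to be stored, here in \<open>m\<close>.\<close>
    let ?A = "\<lambda>p F h s. s m = 0 \<and> beta p F h (s m) (s (m + 1)) \<and>
      computes f (map s is') (s (m + 1))"
    let ?A' = "\<lambda>p F h s. \<exists>z r. ?A p F h (s(m := z, m + 1 := r))"
    \<comment> \<open>Slots \<open>m\<close> and \<open>m + 1\<close> hold consecutive indices,
      \<open>m + 2\<close> and \<open>m + 3\<close> the entries of the history there.\<close>
    let ?B = "\<lambda>p F h s. s (m + 1) = Suc (s m) \<and> beta p F h (s m) (s (m + 2)) \<and>
      beta p F h (s (m + 1)) (s (m + 3)) \<and>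
      computes g (map s (m # (m + 2) # is')) (s (m + 3))"
    let ?B' = "\<lambda>p F h s. \<exists>k' r r'. ?B p F h (s(m + 1 := k', m + 2 := r, m + 3 := r'))"
    \<comment> \<open>A bounded universal quantifier, left with unreduced updates to match the shape
      produced by \<open>definable_ex\<close>.\<close>
    let ?B'' = "\<lambda>p F h s. \<not> (\<exists>k. (s(m := k)) m < (s(m := k)) i \<and> \<not> ?B' p F h (s(m := k)))"
    have A: "definable ?A'"
      by (intro definable_ex[of "\<lambda>p F h s. \<exists>r. ?A p F h (s(m + 1 := r))"] definable_ex[of ?A]
          definable_conj definable_eq_0 definable_beta RPrim.IH)
    have B: "definable ?B'"
      by (intro definable_ex[of "\<lambda>p F h s. \<exists>r r'. ?B p F h (s(m + 2 := r, m + 3 := r'))"]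
          definable_ex[of "\<lambda>p F h s. \<exists>r'. ?B p F h (s(m + 3 := r'))"] definable_ex[of ?B]
          definable_conj definable_Suc definable_beta RPrim.IH)
    have B': "definable ?B''"
      by (intro definable_not definable_ex[of "\<lambda>p F h s. s m < s i \<and> \<not> ?B' p F h s"]
          definable_conj definable_less B)
    have "definable (\<lambda>p _ _ s. \<exists>F\<in>C. \<exists>h\<in>C. ?A' p F h s \<and> ?B'' p F h s \<and> beta p F h (s i) (s j))"
      by (intro definable_ex_F definable_ex_h[of "\<lambda>p F h s. ?A' p F h s \<and> ?B'' p F h s \<and>
            beta p F h (s i) (s j)"] definable_conj A B' definable_beta)
    then show ?thesis
    proof (rule definable_cong)
      fix p F0 h0 s
      assume p: "p \<in> C" "good p"
      have "?A' p F h s \<longleftrightarrow> (\<exists>r. beta p F h 0 r \<and> computes f (map s is') r)" for F h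
        using m ij by simp
      moreover have "?B'' p F h s \<longleftrightarrow> (\<forall>k<s i. \<exists>r r'. beta p F h k r \<and> beta p F h (Suc k) r' \<and>
          computes g (k # r # map s is') r')" for F h
        using m ij by simp
      moreover have "(\<exists>F\<in>C. \<exists>h\<in>C. (\<exists>r. beta p F h 0 r \<and> computes f (map s is') r) \<and>
          (\<forall>k<s i. \<exists>r r'. beta p F h k r \<and> beta p F h (Suc k) r' \<and> computes g (k # r # map s is') r') \<and>
          beta p F h (s i) (s j)) \<longleftrightarrow> computes (RPrim f g) (map s is) (s j)" (is "?L \<longleftrightarrow> ?R")
      proof
        assume ?L
        then obtain F h where FA: "\<exists>r. beta p F h 0 r \<and> computes f (map s is') r"
          and FB: "\<forall>k<s i. \<exists>r r'. beta p F h k r \<and> beta p F h (Suc k) r' \<and>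
            computes g (k # r # map s is') r'"
          and FC: "beta p F h (s i) (s j)" by blast
        \<comment> \<open>The formula itself asserts a coded value at each index up to
          \<open>s i\<close>, so uniqueness is enough to read off a history from arbitrary
          \<open>F\<close> and \<open>h\<close>.\<close>
        define a where "a k = (THE r. beta p F h k r)" for k
        have a: "a k = r" if "beta p F h k r" for k r
          unfolding a_def using that beta_unique by blast
        show ?R unfolding Cons list.map computes_RPrim_iff
        proof (intro exI[of _ a] conjI allI impI)
          show "computes f (map s is') (a 0)" using FA a by auto
          show "a (s i) = s j" using FC a by simp
          show "computes g (k # a k # map s is') (a (Suc k))" if "k < s i" for k
            using FB that a by fastforce
        qed
      next
        assume ?R
        then obtain a where a: "computes f (map s is') (a 0)"
          "\<forall>k<s i. computes g (k # a k # map s is') (a (Suc k))" "a (s i) = s j"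
          unfolding Cons list.map computes_RPrim_iff by blast
        \<comment> \<open>A recursion of \<open>s i\<close> steps has \<open>s i + 1\<close> history
          entries.\<close>
        obtain F h where Fh: "F \<in> C" "h \<in> C" "\<forall>k<Suc (s i). beta p F h k (a k)"
          using beta_exists[OF p] by blast
        then have "beta p F h 0 (a 0)" "beta p F h (s i) (s j)"
          "\<And>k. k < s i \<Longrightarrow> beta p F h k (a k) \<and> beta p F h (Suc k) (a (Suc k))"
          using a(3) by (auto simp del: a(3) simp: a(3)[symmetric])
        with a Fh(1,2) show ?L by metis
      qed
      ultimately show "(\<exists>F\<in>C. \<exists>h\<in>C. ?A' p F h s \<and> ?B'' p F h s \<and> beta p F h (s i) (s j)) \<longleftrightarrow>
          computes (RPrim f g) (map s is) (s j)"
        by (simp only:)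
    qed
  qed
next
  case (RMu f)
  define m where "m = Suc (Max (insert j (set is)))"
  have "j < m" "\<forall>i\<in>set is. i < m"
    unfolding m_def by (simp_all add: less_Suc_eq_le)
  then have m: "j < m" "k \<notin> set is" if "m \<le> k" for k
    using that by auto
  then have "j < m" by auto
  let ?A = "\<lambda>p F h s. s m = 0 \<and> computes f (map s (j # is)) (s m)"
  let ?B = "\<lambda>p F h s. s (m + 1) = Suc (s (m + 2)) \<and> computes f (map s (m # is)) (s (m + 1))"
  let ?B' = "\<lambda>p F h s. \<exists>y' y. ?B p F h (s(m + 1 := y', m + 2 := y))"
  have "definable ?B'"
    by (intro definable_ex[of "\<lambda>p F h s. \<exists>y. ?B p F h (s(m + 2 := y))"] definable_ex[of ?B]
        definable_conj definable_Suc RMu.IH)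
  then have "definable (\<lambda>p F h s. (\<exists>z. ?A p F h (s(m := z))) \<and>
      \<not> (\<exists>k. (s(m := k)) m < (s(m := k)) j \<and> \<not> ?B' p F h (s(m := k))))"
    by (intro definable_conj definable_not definable_ex[of ?A] definable_eq_0 RMu.IH
        definable_ex[of "\<lambda>p F h s. s m < s j \<and> \<not> ?B' p F h s"] definable_less)
  moreover have "(\<exists>y'. (\<exists>y. y' = Suc y) \<and> P y') \<longleftrightarrow> (\<exists>y. P (Suc y))" for P
    by auto
  ultimately show ?case
    by (elim definable_cong) (use m \<open>j < m\<close> in \<open>simp add: computes_RMu_iff\<close>)
qed

end

section \<open>Diagonalization\<close>

lemma tm_val_cong: "(\<And>i. i \<in> tm_vars t \<Longrightarrow> e i = e' i) \<Longrightarrow> tm_val R e t = tm_val R e' t"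
  by (induction t) simp_all

lemma sat_cong: "(\<And>i. i \<in> free_vars \<phi> \<Longrightarrow> e i = e' i) \<Longrightarrow> sat R e \<phi> \<longleftrightarrow> sat R e' \<phi>"
proof (induction \<phi> arbitrary: e e')
  case (Eq s t)
  then show ?case using tm_val_cong[of s e e' R] tm_val_cong[of t e e' R] by simp
next
  case (Neg \<phi>)
  from Neg.IH[of e e'] Neg.prems show ?case by simp
next
  case (Conj \<phi> \<psi>)
  from Conj.IH(1)[of e e'] Conj.IH(2)[of e e'] Conj.prems show ?case by simp
next
  case (Exists i \<phi>)
  have "sat R (e(i := a)) \<phi> \<longleftrightarrow> sat R (e'(i := a)) \<phi>" for a
    by (rule Exists.IH) (use Exists.prems in auto)
  then show ?case by simp
qed

lemma finite_tm_vars: "finite (tm_vars t)"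
  by (induction t) simp_all

lemma finite_free_vars: "finite (free_vars \<phi>)"
  by (induction \<phi>) (simp_all add: finite_tm_vars)

text \<open>Definability leaves variables free whose values are irrelevant. Fixing them to 1 is
  safe: 1 lies in the carrier and is \<open>p^0\<close>, so the assignment still has the form
  \<open>env\<close>.\<close>

definition set_ones :: "nat list \<Rightarrow> fm \<Rightarrow> fm" where
  "set_ones L \<phi> = foldr (\<lambda>i \<psi>. Exists i (Conj (Eq (Var i) One) \<psi>)) L \<phi>"

lemma free_vars_set_ones: "free_vars (set_ones L \<phi>) = free_vars \<phi> - set L"
  by (induction L) (auto simp: set_ones_def)

primrec power_tm :: "nat \<Rightarrow> tm" where
  "power_tm 0 = One"
| "power_tm (Suc n) = Mul (Var 0) (power_tm n)"

lemma tm_vars_power_tm: "tm_vars (power_tm n) \<subseteq> {0}"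
  by (induction n) auto

text \<open>Self-application by an equation instead of a substitution: variable 4, where
  \<open>env\<close> stores the number with index 0, is set to the power whose exponent is the
  code.\<close>

definition diag :: "fm \<Rightarrow> fm" where
  "diag \<phi> = Exists 0 (Exists 4 (Conj (Eq (Var 4) (power_tm (fm_code \<phi>))) \<phi>))"

lemma sentence_diag: "free_vars \<phi> \<subseteq> {0, 4} \<Longrightarrow> sentence (diag \<phi>)"
  using tm_vars_power_tm[of "fm_code \<phi>"] by (auto simp: sentence_def diag_def)

section \<open>A program for the code of the diagonal sentence\<close>

lemma computes_comp1: "computes g xs y \<Longrightarrow> computes f [y] z \<Longrightarrow> computes (RComp f [g]) xs z"
  by (rule computes.comp[of xs "[g]" "[y]"]) simp_all

lemma computes_comp2:
  "computes g xs y \<Longrightarrow> computes h xs y' \<Longrightarrow> computes f [y, y'] z \<Longrightarrow> computes (RComp f [g, h]) xs z"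
  by (rule computes.comp[of xs "[g, h]" "[y, y']"]) simp_all

lemma computes_proj_eq: "i < length xs \<Longrightarrow> y = xs ! i \<Longrightarrow> computes (RProj i) xs y"
  using computes.proj by simp

definition add_prog :: recf where
  "add_prog = RPrim (RProj 0) (RComp RSucc [RProj 1])"

lemma computes_add_prog: "computes add_prog [m, n] (m + n)"
  unfolding add_prog_def
proof (induction m)
  case 0
  show ?case by (auto intro!: computes.prim_0 computes_proj_eq)
next
  case (Suc m)
  then show ?case
    by (rule computes.prim_Suc) (auto intro!: computes_comp1 computes_proj_eq computes.succ)
qed

definition triangle_prog :: recf where
  "triangle_prog = RPrim RZero (RComp add_prog [RProj 1, RComp RSucc [RProj 0]])"

lemma computes_triangle_prog: "computes triangle_prog [n] (triangle n)"
  unfolding triangle_prog_def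
proof (induction n)
  case 0
  show ?case by (auto intro!: computes.prim_0 computes.zero)
next
  case (Suc n)
  have "computes (RComp add_prog [RProj 1, RComp RSucc [RProj 0]]) [n, triangle n]
      (triangle n + Suc n)"
    by (rule computes_comp2[OF _ computes_comp1 computes_add_prog])
      (auto intro!: computes_proj_eq computes.succ)
  with Suc show ?case by (simp add: computes.prim_Suc)
qed

text \<open>\<open>prod_encode (a, b)\<close> is Cantor's pairing
  \<open>triangle (a + b) + a\<close>.\<close>

definition pair_prog :: "recf \<Rightarrow> recf \<Rightarrow> recf" where
  "pair_prog f g = RComp add_prog [RComp triangle_prog [RComp add_prog [f, g]], f]"

lemma computes_pair_prog:
  assumes "computes f xs a" "computes g xs b"
  shows "computes (pair_prog f g) xs (prod_encode (a, b))"
  unfolding pair_prog_def prod_encode_def prod.case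
  by (intro computes_comp2[OF computes_comp1[OF computes_comp2[OF assms computes_add_prog]
          computes_triangle_prog] assms(1) computes_add_prog])

primrec const_prog :: "nat \<Rightarrow> recf" where
  "const_prog 0 = RZero"
| "const_prog (Suc c) = RComp RSucc [const_prog c]"

lemma computes_const_prog: "computes (const_prog c) xs c"
  by (induction c) (auto intro: computes.zero computes_comp1 computes.succ)

definition power_tm_prog :: recf where
  "power_tm_prog = RPrim (const_prog (tm_code One))
    (pair_prog (const_prog 4) (pair_prog (const_prog (tm_code (Var 0))) (RProj 1)))"

lemma computes_power_tm_prog: "computes power_tm_prog [n] (tm_code (power_tm n))"
  unfolding power_tm_prog_def
proof (induction n)
  case 0
  show ?case
    unfolding power_tm.simps(1) by (intro computes.prim_0 computes_const_prog)
next
  case (Suc n)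
  then show ?case
    unfolding power_tm.simps(2) tm_code.simps(5)
    by (elim computes.prim_Suc)
      (intro computes_pair_prog computes_const_prog computes_proj_eq, simp_all)
qed

text \<open>The constants are the constructor tags of \<open>Exists\<close>, \<open>Conj\<close> and
  \<open>Eq\<close>, interleaved with the bound variables 0 and 4.\<close>

definition diag_prog :: recf where
  "diag_prog = pair_prog (const_prog 3) (pair_prog (const_prog 0) (pair_prog (const_prog 3)
    (pair_prog (const_prog 4) (pair_prog (const_prog 2) (pair_prog
      (pair_prog (const_prog 0) (pair_prog (const_prog (tm_code (Var 4))) power_tm_prog))
      (RProj 0))))))"

lemma computes_diag_prog: "computes diag_prog [fm_code \<phi>] (fm_code (diag \<phi>))"
  unfolding diag_prog_def diag_def fm_code.simps
  by (intro computes_pair_prog computes_const_prog computes_power_tm_prog computes_proj_eq) simp_all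

context graded_domain
begin

lemma sat_set_ones:
  "sat alg e (set_ones L \<phi>) \<longleftrightarrow> sat alg (\<lambda>i. if i \<in> set L then 1 else e i) \<phi>"
proof (induction L arbitrary: e)
  case (Cons i L)
  have "sat alg e (set_ones (i # L) \<phi>) \<longleftrightarrow> sat alg (e(i := 1)) (set_ones L \<phi>)"
    by (auto simp: set_ones_def)
  also have "\<dots> \<longleftrightarrow> sat alg (\<lambda>k. if k \<in> set L then 1 else (e(i := 1)) k) \<phi>"
    by (rule Cons.IH)
  also have "(\<lambda>k. if k \<in> set L then 1 else (e(i := 1)) k) =
      (\<lambda>k. if k \<in> set (i # L) then 1 else e k)" by auto
  finally show ?case .
qed (simp add: set_ones_def)

lemma tm_val_power_tm: "tm_val alg e (power_tm n) = e 0 ^ n"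
  by (induction n) simp_all

text \<open>\<open>g\<close> outputs 0 on the code of a formula iff its diagonal sentence is
  rejected. For the formula \<open>\<delta>\<close> expressing this very output, the diagonal
  sentence holds iff it is not in the theory.\<close>

theorem undecidable_fo_theory:
  assumes q: "q \<in> C" "good q"
  shows "\<not> decidable_theory (fo_theory alg)"
proof
  let ?T = "fo_theory alg"
  assume "decidable_theory ?T"
  then obtain f where f: "\<And>n. computes f [n] (if n \<in> fm_code ` ?T then 1 else 0)"
    unfolding decidable_theory_def decidable_set_def by blast
  define g where "g = RComp f [diag_prog]"
  have g: "computes g [fm_code \<phi>] 0 \<longleftrightarrow> diag \<phi> \<notin> ?T" for \<phi>
  proof -
    have "computes g [fm_code \<phi>] (if fm_code (diag \<phi>) \<in> fm_code ` ?T then 1 else 0)"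
      unfolding g_def using computes_diag_prog f by (rule computes_comp1)
    moreover have "fm_code (diag \<phi>) \<in> fm_code ` ?T \<longleftrightarrow> diag \<phi> \<in> ?T"
      by (auto simp: fm_code_inject)
    ultimately have "computes g [fm_code \<phi>] (if diag \<phi> \<in> ?T then 1 else 0)" by simp
    then show ?thesis using computes_deterministic by (auto split: if_splits)
  qed
  have "definable (\<lambda>_ _ _ s. \<exists>z. (s(1 := z)) 1 = 0 \<and> computes g (map (s(1 := z)) [0]) ((s(1 := z)) 1))"
    by (intro definable_ex[of "\<lambda>_ _ _ s. s 1 = 0 \<and> computes g (map s [0]) (s 1)"]
        definable_conj definable_eq_0 definable_computes)
  then have "definable (\<lambda>_ _ _ s. computes g [s 0] 0)"
    by (rule definable_cong) simp
  then obtain \<phi> where \<phi>: "\<And>p F h u s. p \<in> C \<Longrightarrow> good p \<Longrightarrow> F \<in> C \<Longrightarrow> h \<in> C \<Longrightarrow> u \<in> C \<Longrightarrow>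
    sat alg (env p F h u s) \<phi> \<longleftrightarrow> computes g [s 0] 0"
    by (rule definableE) (rule that)
  define L where "L = sorted_list_of_set (free_vars \<phi> - {0, 4})"
  have L: "set L = free_vars \<phi> - {0, 4}" by (simp add: L_def finite_free_vars)
  \<comment> \<open>The behaviour of \<open>\<phi>\<close> is known only for good parameters, so the
    quantifier in \<open>diag\<close> must be restricted to them.\<close>
  define \<delta> where "\<delta> = Conj good_fm (set_ones L \<phi>)"
  have "free_vars \<delta> \<subseteq> {0, 4}"
    by (auto simp: \<delta>_def free_vars_good_fm free_vars_set_ones L)
  then have sentence: "sentence (diag \<delta>)" by (rule sentence_diag)
  have \<delta>: "sat alg (e(0 := p, 4 := p ^ n)) \<delta> \<longleftrightarrow> good p \<and> computes g [n] 0" if "p \<in> C" for e p n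
  proof -
    let ?e = "e(0 := p, 4 := p ^ n)"
    have "sat alg ?e (set_ones L \<phi>) \<longleftrightarrow> sat alg (env p 1 1 1 (\<lambda>k. if k = 0 then n else 0)) \<phi>"
      unfolding sat_set_ones by (rule sat_cong) (auto simp: L env_def)
    then show ?thesis
      using \<phi>[OF that, of 1 1 1 "\<lambda>k. if k = 0 then n else 0"] that
      by (auto simp: \<delta>_def sat_good_fm)
  qed
  have "sat alg e (diag \<delta>) \<longleftrightarrow> computes g [fm_code \<delta>] 0" for e
  proof -
    have "sat alg e (diag \<delta>) \<longleftrightarrow> (\<exists>p\<in>C. sat alg (e(0 := p, 4 := p ^ fm_code \<delta>)) \<delta>)"
      by (auto simp: diag_def tm_val_power_tm)
    \<comment> \<open>The right-hand side does not mention the parameter, so every good one gives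
      the same answer; \<open>q\<close> ensures that there is one.\<close>
    also have "\<dots> \<longleftrightarrow> computes g [fm_code \<delta>] 0"
      using q \<delta> by auto
    finally show ?thesis .
  qed
  \<comment> \<open>Without an assignment into the carrier, membership in \<open>?T\<close> would be
    vacuous.\<close>
  moreover have "\<exists>e :: nat \<Rightarrow> 'a. range e \<subseteq> C" by (rule exI[of _ "\<lambda>_. 0"]) auto
  ultimately have "diag \<delta> \<in> ?T \<longleftrightarrow> computes g [fm_code \<delta>] 0"
    using sentence by (auto simp: fo_theory_def)
  with g show False by blast
qed

end

section \<open>The free algebra is a graded domain\<close>

abbreviation wlen :: "'x word \<Rightarrow> nat" where
  "wlen w \<equiv> length (letters w)"

lemma wlen_add [simp]: "wlen (u + v) = wlen u + wlen v"
  by (simp add: plus_word_def)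

lemma wlen_eq_0: "wlen w = 0 \<Longrightarrow> w = 0"
  by (cases w) (simp add: zero_word_def)

lemma word_add_cancel: "u + v = u' + v' \<Longrightarrow> wlen u = wlen u' \<Longrightarrow> u = u' \<and> v = v'"
  by (cases u; cases u'; cases v; cases v') (simp add: plus_word_def)

text \<open>A substitute for leading terms without a monomial order: a unique factorization within
  the supports rules out cancellation.\<close>

lemma lookup_mult_unique:
  fixes f g :: "'a::monoid_add \<Rightarrow>\<^sub>0 'b::semiring_0"
  assumes "\<And>u' v'. u' \<in> Poly_Mapping.keys f \<Longrightarrow> v' \<in> Poly_Mapping.keys g \<Longrightarrow>
    u' + v' = u + v \<Longrightarrow> u' = u \<and> v' = v"
  shows "Poly_Mapping.lookup (f * g) (u + v) = Poly_Mapping.lookup f u * Poly_Mapping.lookup g v"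
proof -
  let ?f = "Poly_Mapping.lookup f" and ?g = "Poly_Mapping.lookup g"
  have "Poly_Mapping.lookup (f * g) (u + v) = (\<Sum>(a, b). ?f a * ?g b when u + v = a + b)"
    by (simp add: times_poly_mapping.rep_eq prod_fun_unfold_prod)
  also have "\<dots> = (\<Sum>x. (?f u * ?g v) when x = (u, v))"
  proof (rule Sum_any.cong, clarify)
    fix a b
    show "(?f a * ?g b when u + v = a + b) = ((?f u * ?g v) when (a, b) = (u, v))"
      using assms[of a b] by (cases "?f a = 0 \<or> ?g b = 0") (auto simp: when_def in_keys_iff)
  qed
  finally show ?thesis by simp
qed

definition word_degree :: "('x, 'k::zero) ncpoly \<Rightarrow> nat" where
  "word_degree f = Max (insert 0 (wlen ` Poly_Mapping.keys f))"

lemma wlen_le_word_degree: "w \<in> Poly_Mapping.keys f \<Longrightarrow> wlen w \<le> word_degree f"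
  unfolding word_degree_def by (intro Max_ge) auto

lemma word_degree_le: "(\<And>w. w \<in> Poly_Mapping.keys f \<Longrightarrow> wlen w \<le> n) \<Longrightarrow> word_degree f \<le> n"
  unfolding word_degree_def by (subst Max_le_iff) auto

lemma longest_word:
  assumes "f \<noteq> 0"
  obtains w where "w \<in> Poly_Mapping.keys f" "wlen w = word_degree f"
proof -
  have "word_degree f \<in> insert 0 (wlen ` Poly_Mapping.keys f)"
    unfolding word_degree_def by (intro Max_in) auto
  moreover obtain v where v: "v \<in> Poly_Mapping.keys f"
    using assms by (metis keys_eq_empty ex_in_conv)
  moreover have "wlen v \<le> word_degree f" using v by (rule wlen_le_word_degree)
  ultimately show ?thesis using that by (cases "word_degree f = 0") auto
qed

lemma shortest_word:
  fixes f :: "('x, 'k::zero) ncpoly"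
  assumes "f \<noteq> 0"
  shows "\<exists>w\<in>Poly_Mapping.keys f. \<forall>v\<in>Poly_Mapping.keys f. wlen w \<le> wlen v"
proof -
  obtain v where "v \<in> Poly_Mapping.keys f"
    using assms by (metis keys_eq_empty ex_in_conv)
  then show ?thesis
    using ex_has_least_nat[of "\<lambda>w. w \<in> Poly_Mapping.keys f" v wlen] by metis
qed

text \<open>If another pair of words gave \<open>u + v\<close>, neither could be longer than its
  counterpart, so the lengths agree; cutting a word at a given length is unique.\<close>

lemma longest_words_mult:
  fixes f g :: "('x, 'k::semiring_no_zero_divisors) ncpoly"
  assumes "u \<in> Poly_Mapping.keys f" "wlen u = word_degree f"
    and "v \<in> Poly_Mapping.keys g" "wlen v = word_degree g"
  shows "u + v \<in> Poly_Mapping.keys (f * g)"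
proof -
  have "u' = u \<and> v' = v"
    if u': "u' \<in> Poly_Mapping.keys f" and v': "v' \<in> Poly_Mapping.keys g" and e: "u' + v' = u + v"
    for u' v'
  proof (rule word_add_cancel[OF e])
    have "wlen u' + wlen v' = wlen u + wlen v" using arg_cong[OF e, of wlen] by simp
    then show "wlen u' = wlen u"
      using wlen_le_word_degree[OF u'] wlen_le_word_degree[OF v'] assms by simp
  qed
  then have "Poly_Mapping.lookup (f * g) (u + v) = Poly_Mapping.lookup f u * Poly_Mapping.lookup g v"
    by (rule lookup_mult_unique)
  with assms(1,3) show ?thesis by (simp add: in_keys_iff)
qed

lemma shortest_words_mult:
  fixes f g :: "('x, 'k::semiring_no_zero_divisors) ncpoly"
  assumes "u \<in> Poly_Mapping.keys f" "\<And>w. w \<in> Poly_Mapping.keys f \<Longrightarrow> wlen u \<le> wlen w"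
    and "v \<in> Poly_Mapping.keys g" "\<And>w. w \<in> Poly_Mapping.keys g \<Longrightarrow> wlen v \<le> wlen w"
  shows "u + v \<in> Poly_Mapping.keys (f * g)"
proof -
  have "u' = u \<and> v' = v"
    if u': "u' \<in> Poly_Mapping.keys f" and v': "v' \<in> Poly_Mapping.keys g" and e: "u' + v' = u + v"
    for u' v'
  proof (rule word_add_cancel[OF e])
    have "wlen u' + wlen v' = wlen u + wlen v" using arg_cong[OF e, of wlen] by simp
    then show "wlen u' = wlen u"
      using assms(2)[OF u'] assms(4)[OF v'] by simp
  qed
  then have "Poly_Mapping.lookup (f * g) (u + v) = Poly_Mapping.lookup f u * Poly_Mapping.lookup g v"
    by (rule lookup_mult_unique)
  with assms(1,3) show ?thesis by (simp add: in_keys_iff)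
qed

lemma word_degree_mult:
  fixes f g :: "('x, 'k::semiring_no_zero_divisors) ncpoly"
  assumes "f \<noteq> 0" "g \<noteq> 0"
  shows "f * g \<noteq> 0" "word_degree (f * g) = word_degree f + word_degree g"
proof -
  obtain u where u: "u \<in> Poly_Mapping.keys f" "wlen u = word_degree f"
    using longest_word[OF assms(1)] .
  obtain v where v: "v \<in> Poly_Mapping.keys g" "wlen v = word_degree g"
    using longest_word[OF assms(2)] .
  have uv: "u + v \<in> Poly_Mapping.keys (f * g)" using longest_words_mult[OF u v] .
  then show "f * g \<noteq> 0" by auto
  show "word_degree (f * g) = word_degree f + word_degree g"
  proof (rule antisym)
    show "word_degree f + word_degree g \<le> word_degree (f * g)"
      using wlen_le_word_degree[OF uv] u v by simp
    show "word_degree (f * g) \<le> word_degree f + word_degree g"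
    proof (rule word_degree_le)
      fix w assume "w \<in> Poly_Mapping.keys (f * g)"
      then obtain a b where "w = a + b" "a \<in> Poly_Mapping.keys f" "b \<in> Poly_Mapping.keys g"
        using keys_mult by blast
      then show "wlen w \<le> word_degree f + word_degree g"
        using wlen_le_word_degree[of a f] wlen_le_word_degree[of b g] by simp
    qed
  qed
qed

lemma word_degree_add:
  fixes f g :: "('x, 'k::monoid_add) ncpoly"
  shows "word_degree (f + g) \<le> max (word_degree f) (word_degree g)"
proof (rule word_degree_le)
  fix w assume "w \<in> Poly_Mapping.keys (f + g)"
  then have "w \<in> Poly_Mapping.keys f \<or> w \<in> Poly_Mapping.keys g"
    using subsetD[OF Poly_Mapping.keys_add] by fast
  then show "wlen w \<le> max (word_degree f) (word_degree g)"
    using wlen_le_word_degree[of w f] wlen_le_word_degree[of w g] by auto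
qed

lemma poly_mapping_eq_single:
  "Poly_Mapping.keys f \<subseteq> {w} \<Longrightarrow> f = Poly_Mapping.single w (Poly_Mapping.lookup f w)"
  by (rule poly_mapping_eqI) (auto simp: lookup_single when_def in_keys_iff)

lemma graded_domain_free_algebra:
  "graded_domain (carrier (free_algebra X :: ('x, 'k::field) ncpoly ring)) word_degree"
proof -
  let ?F = "free_algebra X :: ('x, 'k) ncpoly ring"
  interpret ring ?F by (rule ring_free_algebra)
  have ops: "\<zero>\<^bsub>?F\<^esub> = 0" "\<one>\<^bsub>?F\<^esub> = 1" "a \<oplus>\<^bsub>?F\<^esub> b = a + b" "a \<otimes>\<^bsub>?F\<^esub> b = a * b" for a b
    by (simp_all add: free_algebra_def)
  show ?thesis
  proof
    fix a b :: "('x, 'k) ncpoly"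
    show "0 \<in> carrier ?F" "1 \<in> carrier ?F"
      using zero_closed one_closed by (simp_all add: ops)
    show "- a \<in> carrier ?F" if "a \<in> carrier ?F"
      using that by (simp add: free_algebra_def keys_minus)
    show "a + b \<in> carrier ?F" "a * b \<in> carrier ?F" if "a \<in> carrier ?F" "b \<in> carrier ?F"
      using that add.m_closed m_closed by (simp_all add: ops flip: ops(3,4))
    show "a * b = 0 \<Longrightarrow> a = 0 \<or> b = 0" using word_degree_mult(1) by blast
    show "a \<noteq> 0 \<Longrightarrow> b \<noteq> 0 \<Longrightarrow> word_degree (a * b) = word_degree a + word_degree b"
      by (rule word_degree_mult)
    show "word_degree (a + b) \<le> max (word_degree a) (word_degree b)"
      by (rule word_degree_add)
    assume a: "a \<in> carrier ?F" "a \<noteq> 0" "word_degree a = 0"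
    define c where "c = Poly_Mapping.lookup a 0"
    have "Poly_Mapping.keys a \<subseteq> {0}"
      using wlen_le_word_degree[of _ a] a(3) wlen_eq_0 by auto
    then have ac: "a = Poly_Mapping.single 0 c"
      unfolding c_def by (rule poly_mapping_eq_single)
    with a have "c \<noteq> 0" by auto
    then have "a * Poly_Mapping.single 0 (inverse c) = 1"
      by (simp add: ac mult_single)
    moreover have "Poly_Mapping.single 0 (inverse c) \<in> carrier ?F"
      by (simp add: free_algebra_def zero_word_def)
    ultimately show "\<exists>w\<in>carrier ?F. a * w = 1" by blast
  qed
qed

section \<open>Letters as admissible parameters\<close>

abbreviation letter :: "'x \<Rightarrow> ('x, 'k::semiring_1) ncpoly" where
  "letter x \<equiv> Poly_Mapping.single (Word [x]) 1"

lemma letter_power: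
  "letter x ^ n = (Poly_Mapping.single (Word (replicate n x)) 1 :: ('x, 'k::semiring_1) ncpoly)"
  by (induction n) (simp_all add: mult_single plus_word_def flip: zero_word_def)

text \<open>In \<open>d e = x\<^sup>n\<close> the longest words of \<open>d\<close> and \<open>e\<close> multiply to \<open>x\<^sup>n\<close>, and so do the shortest
  ones; hence \<open>d\<close> and \<open>e\<close> are homogeneous.\<close>

lemma mult_eq_letter_power:
  fixes d e :: "('x, 'k::field) ncpoly"
  assumes de: "d * e = letter x ^ n"
  obtains c j where "e = Poly_Mapping.single (Word (replicate j x)) c" "c \<noteq> 0"
proof -
  have keys: "Poly_Mapping.keys (d * e) = {Word (replicate n x)}"
    unfolding de letter_power by simp
  then have "d \<noteq> 0" "e \<noteq> 0" by auto
  obtain u where u: "u \<in> Poly_Mapping.keys d" "wlen u = word_degree d"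
    using longest_word[OF \<open>d \<noteq> 0\<close>] .
  obtain v where v: "v \<in> Poly_Mapping.keys e" "wlen v = word_degree e"
    using longest_word[OF \<open>e \<noteq> 0\<close>] .
  obtain u' where u': "u' \<in> Poly_Mapping.keys d"
    "\<And>w. w \<in> Poly_Mapping.keys d \<Longrightarrow> wlen u' \<le> wlen w"
    using shortest_word[OF \<open>d \<noteq> 0\<close>] by metis
  obtain v' where v': "v' \<in> Poly_Mapping.keys e"
    "\<And>w. w \<in> Poly_Mapping.keys e \<Longrightarrow> wlen v' \<le> wlen w"
    using shortest_word[OF \<open>e \<noteq> 0\<close>] by metis
  have uv: "u + v = Word (replicate n x)" "u' + v' = Word (replicate n x)"
    using longest_words_mult[OF u v] shortest_words_mult[OF u' v'] keys by simp_all
  then have len: "wlen u + wlen v = wlen u' + wlen v'" by (simp flip: wlen_add)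
  have "wlen u' \<le> wlen u" "wlen v' \<le> wlen v" using u(1) v(1) u'(2) v'(2) by blast+
  with len have "wlen v' = word_degree e" using v by simp
  have "w = v" if w: "w \<in> Poly_Mapping.keys e" for w
  proof -
    have "wlen w = word_degree e"
      using v'(2)[OF w] wlen_le_word_degree[OF w] \<open>wlen v' = word_degree e\<close> by simp
    \<comment> \<open>Every word of \<open>e\<close> has maximal length, so each contributes a word
      to the product, whose support is a single word.\<close>
    then have "u + w = u + v" using longest_words_mult[OF u w] keys uv(1) by simp
    then show ?thesis using word_add_cancel by blast
  qed
  then have "Poly_Mapping.keys e \<subseteq> {v}" by blast
  then have e: "e = Poly_Mapping.single v (Poly_Mapping.lookup e v)"
    by (rule poly_mapping_eq_single)
  have "letters u @ letters v = replicate n x" using uv(1) by (simp add: plus_word_def)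
  then have "\<forall>y\<in>set (letters v). y = x" by (metis Un_iff in_set_replicate set_append)
  then have "letters v = replicate (wlen v) x" by (simp add: replicate_length_same)
  then have "v = Word (replicate (wlen v) x)" by (metis word.collapse)
  with e v(1) that show ?thesis by (metis in_keys_iff)
qed

lemma good_letter:
  fixes X :: "'x set"
  assumes "x \<in> X"
  defines "C \<equiv> carrier (free_algebra X :: ('x, 'k::field) ncpoly ring)"
  shows "letter x \<in> C" "graded_domain.good C (letter x)"
proof -
  interpret graded_domain C word_degree
    unfolding C_def by (rule graded_domain_free_algebra)
  let ?x = "letter x :: ('x, 'k) ncpoly"
  have C: "Poly_Mapping.single (Word (replicate j x)) c \<in> C" for j and c :: 'k
    using assms by (auto simp: C_def free_algebra_def split: if_splits)
  show x: "?x \<in> C" using C[of 1 1] by simp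
  have "Poly_Mapping.keys ?x \<noteq> {}" by simp
  then have nz: "?x \<noteq> 0" by (metis keys_zero)
  have deg: "word_degree ?x > 0"
    using wlen_le_word_degree[of "Word [x]" ?x] by simp
  have pdivs: "pdivs ?x (?x ^ n)" for n
    unfolding pdivs_def
  proof (intro ballI impI)
    fix d e assume "d * e = ?x ^ n"
    then obtain c j where e: "e = Poly_Mapping.single (Word (replicate j x)) c" "c \<noteq> 0"
      by (rule mult_eq_letter_power)
    show "(\<exists>w\<in>C. e * w = 1) \<or> (\<exists>g\<in>C. e = ?x * g)"
    proof (cases j)
      case 0
      have "e * Poly_Mapping.single 0 (inverse c) = 1"
        using e 0 by (simp add: mult_single flip: zero_word_def)
      moreover have "Poly_Mapping.single 0 (inverse c) \<in> C"
        using C[of 0 "inverse c"] by (simp add: zero_word_def)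
      ultimately show ?thesis by blast
    next
      case (Suc i)
      then have "e = ?x * Poly_Mapping.single (Word (replicate i x)) c"
        by (simp add: e mult_single plus_word_def)
      then show ?thesis using C by blast
    qed
  qed
  \<comment> \<open>There is no circularity: \<open>pow_imp_power\<close> needs only positive
    degree, and once \<open>b\<close> is an actual power, the next power satisfies
    \<open>pow\<close> by the geometric sum and the factorization of letter powers.\<close>
  have "pow ?x (?x * b)" if b: "b \<in> C" "pow ?x b" for b
  proof -
    obtain n where n: "b = ?x ^ n" using pow_imp_power[OF x nz deg b] ..
    obtain s where s: "s \<in> C" "?x ^ Suc n - 1 = (?x - 1) * s"
      using geometric_sum_ex[OF x] by blast
    then have "?x ^ Suc n + s = 1 + ?x * s" by (simp add: algebra_simps)
    then show ?thesis unfolding pow_def n using s(1) pdivs[of "Suc n"] by auto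
  qed
  moreover have "\<not> (\<exists>w\<in>C. ?x * w = 1)" using deg deg_right_unit by fastforce
  ultimately show "good ?x" unfolding good_def using nz by blast
qed

theorem theorem7p1:
  fixes X :: "'x set"
  assumes "X \<noteq> {}"
  shows "\<not> decidable_theory (fo_theory (free_algebra X :: ('x, 'k::field) ncpoly ring))"
proof -
  let ?F = "free_algebra X :: ('x, 'k) ncpoly ring"
  interpret graded_domain "carrier ?F" word_degree
    by (rule graded_domain_free_algebra)
  obtain x where "x \<in> X" using assms by blast
  from undecidable_fo_theory[OF good_letter[OF this]]
  have "\<not> decidable_theory (fo_theory alg)" .
  moreover have "alg = ?F"
    unfolding alg_def by (simp add: free_algebra_def)
  ultimately show ?thesis by (simp only: not_False_eq_True)
qed

end
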